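(* Let $n\ge 1$ and suppose $m\ge n^2$. Then $\beta(R(n,m))\ge n^2$. In particular, $\beta_U(n)\ge n^2$.
   Context: The ground field is $\mathbb{C}$. $\operatorname{Mat}_{n,n}$ is the space of $n\times n$ complex matrices. The group $\operatorname{SL}_n\times\operatorname{SL}_n$ acts on $\operatorname{Mat}_{n,n}^m$ by $(A,B)\circ(X_1,\dots,X_m)=(AX_1B^{-1},\dots,AX_mB^{-1})$, and $R(n,m)=\mathbb{C}[\operatorname{Mat}_{n,n}^m]^{\operatorname{SL}_n\times\operatorname{SL}_n}$ is the ring of invariant polynomials, graded by the usual degree of polynomials in the matrix entries. $\beta(R(n,m))$ is the smallest integer $N$ such that the homogeneous invariants of degree $\le N$ generate $R(n,m)$ as a $\mathbb{C}$-algebra, and $\beta_U(n):=\beta(R(n,n^2))$. *)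

theory Defs
  imports
    "HOL-Library.Poly_Mapping"
    "HOL-Library.Extended_Nat"
    "Jordan_Normal_Form.Gauss_Jordan_Elimination"
    "Jordan_Normal_Form.Determinant"
begin

text \<open>Complex polynomials in variables of type \<open>'x\<close>: finitely supported maps from monomials
  to coefficients, where a monomial is its finitely supported exponent function.\<close>

type_synonym 'x cpoly = "('x \<Rightarrow>\<^sub>0 nat) \<Rightarrow>\<^sub>0 complex"

definition const :: "complex \<Rightarrow> 'x cpoly" where
  "const c = Poly_Mapping.single 0 c"

definition peval :: "('x \<Rightarrow> complex) \<Rightarrow> 'x cpoly \<Rightarrow> complex" where
  "peval \<xi> p = (\<Sum>t\<in>Poly_Mapping.keys p. Poly_Mapping.lookup p t *
     (\<Prod>v\<in>Poly_Mapping.keys t. \<xi> v ^ Poly_Mapping.lookup t v))"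

definition mdegree :: "('x \<Rightarrow>\<^sub>0 nat) \<Rightarrow> nat" where
  "mdegree t = (\<Sum>v\<in>Poly_Mapping.keys t. Poly_Mapping.lookup t v)"

text \<open>The zero polynomial is homogeneous of every degree.\<close>

definition homogeneous :: "nat \<Rightarrow> 'x cpoly \<Rightarrow> bool" where
  "homogeneous d p \<longleftrightarrow> (\<forall>t\<in>Poly_Mapping.keys p. mdegree t = d)"

inductive_set generated_subalgebra :: "'x cpoly set \<Rightarrow> 'x cpoly set"
  for S :: "'x cpoly set" where
  const: "const c \<in> generated_subalgebra S"
| gen: "p \<in> S \<Longrightarrow> p \<in> generated_subalgebra S"
| add: "p \<in> generated_subalgebra S \<Longrightarrow> q \<in> generated_subalgebra S \<Longrightarrow>
    p + q \<in> generated_subalgebra S"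
| mult: "p \<in> generated_subalgebra S \<Longrightarrow> q \<in> generated_subalgebra S \<Longrightarrow>
    p * q \<in> generated_subalgebra S"

text \<open>The least degree bound for homogeneous generators, as an extended natural number: the infimum
  is the minimum of the set if some bound exists, and \<open>\<infinity>\<close> otherwise.\<close>

definition beta :: "'x cpoly set \<Rightarrow> enat" where
  "beta R = Inf {enat N | N. generated_subalgebra {p \<in> R. \<exists>d\<le>N. homogeneous d p} = R}"

definition Mat_tuples :: "nat \<Rightarrow> nat \<Rightarrow> complex mat list set" where
  "Mat_tuples n m = {Xs. length Xs = m \<and> set Xs \<subseteq> carrier_mat n n}"

text \<open>The variable \<open>(k, i, j)\<close> stands for the entry in row \<open>i\<close> and column \<open>j\<close> of the \<open>k\<close>-th
  matrix; all indices start at 0.\<close>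

definition Mat_poly_ring :: "nat \<Rightarrow> nat \<Rightarrow> (nat \<times> nat \<times> nat) cpoly set" where
  "Mat_poly_ring n m =
     {p. \<forall>t\<in>Poly_Mapping.keys p. Poly_Mapping.keys t \<subseteq> {..<m} \<times> {..<n} \<times> {..<n}}"

definition eval_at :: "complex mat list \<Rightarrow> (nat \<times> nat \<times> nat) cpoly \<Rightarrow> complex" where
  "eval_at Xs = peval (\<lambda>(k, i, j). (Xs ! k) $$ (i, j))"

definition SL :: "nat \<Rightarrow> complex mat set" where
  "SL n = {A \<in> carrier_mat n n. det A = 1}"

text \<open>Only used for invertible \<open>B\<close>, where \<open>mat_inverse\<close> returns \<open>Some\<close> of the inverse.\<close>

definition act :: "complex mat \<times> complex mat \<Rightarrow> complex mat list \<Rightarrow> complex mat list" where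
  "act = (\<lambda>(A, B) Xs. map (\<lambda>X. A * X * the (mat_inverse B)) Xs)"

definition R :: "nat \<Rightarrow> nat \<Rightarrow> (nat \<times> nat \<times> nat) cpoly set" where
  "R n m = {p \<in> Mat_poly_ring n m.
     \<forall>g \<in> SL n \<times> SL n. \<forall>Xs \<in> Mat_tuples n m. eval_at (act g Xs) p = eval_at Xs p}"

definition beta_U :: "nat \<Rightarrow> enat" where
  "beta_U n = beta (R n (n\<^sup>2))"

end

theory Submission
  imports Defs "Jordan_Normal_Form.Schur_Decomposition"
begin

text \<open>The determinant \<open>f\<close> of the \<open>n\<^sup>2 \<times> n\<^sup>2\<close> matrix whose rows are the entries of
  \<open>n\<^sup>2\<close> of the matrices is invariant, since \<open>(A, B)\<close> multiplies that matrix by a Kronecker product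
  of determinant 1. The alternating sum of the coefficients of the monomials of \<open>f\<close> is a linear
  functional that does not vanish on \<open>f\<close>. It kills every multiple of a homogeneous invariant of
  degree \<open>k\<close> with \<open>0 < k < n\<^sup>2\<close>, so it kills the nonconstant part of every polynomial generated in
  degrees below \<open>n\<^sup>2\<close>. This amounts to the vanishing of the \<open>SL\<^sub>n \<times> SL\<^sub>n\<close>-invariants in
  \<open>\<Lambda>\<^sup>k(V \<otimes> W)\<close>: on the alternating coefficients of an invariant the left and the right action
  each give an identity for a Jucys-Murphy element with eigenvalue \<open>k/n - n\<close>, and the two elements
  are opposite to each other, which forces \<open>k = n\<^sup>2\<close>.\<close>

section \<open>Invariant tensors\<close>

text \<open>The product vanishes unless \<open>\<rho>\<close> agrees with \<open>\<sigma>\<close> on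
  \<open>S\<close>, and \<open>restrict \<sigma> S\<close> is the only extensional function that
  does. This collapses sums against diagonal matrices and matrix units.\<close>

lemma sum_PiE_delta:
  fixes f :: "('a \<Rightarrow> 'b) \<Rightarrow> 'c :: comm_semiring_1"
  assumes fin: "finite S" "finite T" and \<sigma>: "\<sigma> \<in> S \<rightarrow> T"
  shows "(\<Sum>\<rho>\<in>S \<rightarrow>\<^sub>E T. f \<rho> * (\<Prod>s\<in>S. if \<rho> s = \<sigma> s then w s else 0)) =
    f (restrict \<sigma> S) * (\<Prod>s\<in>S. w s)"
proof -
  have "(\<Sum>\<rho>\<in>S \<rightarrow>\<^sub>E T. f \<rho> * (\<Prod>s\<in>S. if \<rho> s = \<sigma> s then w s else 0)) =
    (\<Sum>\<rho>\<in>S \<rightarrow>\<^sub>E T. if \<rho> = restrict \<sigma> S then f (restrict \<sigma> S) * (\<Prod>s\<in>S. w s) else 0)"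
  proof (rule sum.cong[OF refl])
    fix \<rho> assume \<rho>: "\<rho> \<in> S \<rightarrow>\<^sub>E T"
    show "f \<rho> * (\<Prod>s\<in>S. if \<rho> s = \<sigma> s then w s else 0) =
      (if \<rho> = restrict \<sigma> S then f (restrict \<sigma> S) * (\<Prod>s\<in>S. w s) else 0)"
    proof (cases "\<rho> = restrict \<sigma> S")
      case False
      then obtain s where "s \<in> S" "\<rho> s \<noteq> \<sigma> s"
        using \<rho> by (metis PiE_restrict restrict_ext)
      then have "(\<Prod>s\<in>S. if \<rho> s = \<sigma> s then w s else 0) = 0"
        using fin by (intro prod_zero) auto
      then show ?thesis using False by simp
    qed simp
  qed
  also have "\<dots> = f (restrict \<sigma> S) * (\<Prod>s\<in>S. w s)"
    using fin \<sigma> by (subst sum.delta) (auto intro!: finite_PiE)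
  finally show ?thesis .
qed

text \<open>\<open>c\<close> holds the coordinates of a tensor with one n-dimensional factor per
  position in \<open>S\<close>, invariant under SL_n acting on all factors at once.
  \<open>coeff_cong\<close> allows passing between arbitrary index functions and the extensional
  ones over which the sums run.\<close>

locale SL_tensor =
  fixes n :: nat and S :: "nat set" and c :: "(nat \<Rightarrow> nat) \<Rightarrow> complex"
  assumes finS: "finite S"
    and coeff_cong: "\<And>\<rho> \<rho>'. (\<And>s. s \<in> S \<Longrightarrow> \<rho> s = \<rho>' s) \<Longrightarrow> c \<rho> = c \<rho>'"
    and SL_inv: "\<And>G \<rho>. G \<in> SL n \<Longrightarrow> \<rho> \<in> S \<rightarrow> {..<n} \<Longrightarrow>
      (\<Sum>\<rho>'\<in>S \<rightarrow>\<^sub>E {..<n}. c \<rho>' * (\<Prod>s\<in>S. G $$ (\<rho>' s, \<rho> s))) = c \<rho>"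
begin

lemma sum_delta:
  assumes "\<sigma> \<in> S \<rightarrow> {..<n}"
  shows "(\<Sum>\<rho>\<in>S \<rightarrow>\<^sub>E {..<n}. c \<rho> * (\<Prod>s\<in>S. if \<rho> s = \<sigma> s then w s else 0)) = c \<sigma> * (\<Prod>s\<in>S. w s)"
  using sum_PiE_delta[OF finS _ assms, of c w] coeff_cong[of "restrict \<sigma> S" \<sigma>] by simp

text \<open>The matrix I + z E_ab has determinant 1 for every z, so invariance makes a polynomial in
  z constant. By the product rule its derivative at 0 replaces one index \<open>b\<close> by
  \<open>a\<close> at a time.\<close>

lemma transvection:
  assumes ab: "a < n" "b < n" "a \<noteq> b" and \<rho>: "\<rho> \<in> S \<rightarrow> {..<n}"
  shows "(\<Sum>s\<in>{s\<in>S. \<rho> s = b}. c (\<rho>(s := a))) = 0"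
proof -
  \<comment> \<open>\<open>e \<rho>' s\<close> is the entry of I + z E_ab in row
    \<open>\<rho>' s\<close> and column \<open>\<rho> s\<close>, as a polynomial in z;
    \<open>Q\<close> is then the invariance sum.\<close>
  define e where "e = (\<lambda>\<rho>' s. [:if \<rho>' s = \<rho> s then 1 else 0,
      if \<rho>' s = a \<and> \<rho> s = b then 1 else 0:] :: complex poly)"
  define Q where "Q = (\<Sum>\<rho>'\<in>S \<rightarrow>\<^sub>E {..<n}. smult (c \<rho>') (\<Prod>s\<in>S. e \<rho>' s))"
  have "poly Q z = c \<rho>" for z
  proof -
    have G: "addrow_mat n z a b \<in> SL n"
      using ab by (auto simp: SL_def det_addrow_mat)
    have "addrow_mat n z a b $$ (\<rho>' s, \<rho> s) = poly (e \<rho>' s) z"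
      if "\<rho>' \<in> S \<rightarrow>\<^sub>E {..<n}" "s \<in> S" for \<rho>' s
    proof -
      have "\<rho>' s < n" "\<rho> s < n" using that \<rho> by (auto simp: Pi_iff PiE_iff)
      then show ?thesis using ab unfolding e_def addrow_mat_def by auto
    qed
    then have "poly Q z = (\<Sum>\<rho>'\<in>S \<rightarrow>\<^sub>E {..<n}. c \<rho>' * (\<Prod>s\<in>S. addrow_mat n z a b $$ (\<rho>' s, \<rho> s)))"
      unfolding Q_def by (simp add: poly_sum poly_prod)
    then show ?thesis using SL_inv[OF G \<rho>] by simp
  qed
  then have "poly Q = poly [:c \<rho>:]" by auto
  then have "Q = [:c \<rho>:]" by (simp only: poly_eq_poly_eq_iff)
  then have "0 = poly (pderiv Q) 0" by simp
  also have "\<dots> = (\<Sum>\<rho>'\<in>S \<rightarrow>\<^sub>E {..<n}. \<Sum>s\<in>S.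
      c \<rho>' * (poly (\<Prod>s\<in>S - {s}. e \<rho>' s) 0 * poly (pderiv (e \<rho>' s)) 0))"
    unfolding Q_def
    by (simp add: pderiv_sum pderiv_smult pderiv_prod poly_sum sum_distrib_left)
  also have "\<dots> = (\<Sum>s\<in>S. \<Sum>\<rho>'\<in>S \<rightarrow>\<^sub>E {..<n}.
      c \<rho>' * (poly (\<Prod>s\<in>S - {s}. e \<rho>' s) 0 * poly (pderiv (e \<rho>' s)) 0))"
    by (rule sum.swap)
  also have "\<dots> = (\<Sum>s\<in>S. if \<rho> s = b then c (\<rho>(s := a)) else 0)"
  proof (rule sum.cong[OF refl])
    fix s assume s: "s \<in> S"
    \<comment> \<open>Differentiating the factor at \<open>s\<close> forces
      \<open>\<rho>' s = a\<close> and \<open>\<rho> s = b\<close>. The weight \<open>?w\<close>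
      carries the second condition, so that \<open>sum_delta\<close> applies at
      \<open>\<rho>(s := a)\<close>.\<close>
    let ?w = "\<lambda>t. if t = s \<and> \<rho> s \<noteq> b then 0 else 1 :: complex"
    have w: "(\<Prod>t\<in>S. ?w t) = (if \<rho> s = b then 1 else 0)"
      using s finS by (simp add: prod.remove)
    have *: "poly (\<Prod>s\<in>S - {s}. e \<rho>' s) 0 * poly (pderiv (e \<rho>' s)) 0 =
        (\<Prod>t\<in>S. if \<rho>' t = (\<rho>(s := a)) t then ?w t else 0)" for \<rho>'
    proof -
      have "(\<Prod>t\<in>S. if \<rho>' t = (\<rho>(s := a)) t then ?w t else 0) =
        (if \<rho>' s = a then ?w s else 0) * (\<Prod>t\<in>S - {s}. if \<rho>' t = (\<rho>(s := a)) t then ?w t else 0)"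
        using s finS by (simp add: prod.remove)
      also have "(\<Prod>t\<in>S - {s}. if \<rho>' t = (\<rho>(s := a)) t then ?w t else 0) =
          poly (\<Prod>s\<in>S - {s}. e \<rho>' s) 0"
        unfolding poly_prod by (intro prod.cong) (auto simp: e_def)
      also have "(if \<rho>' s = a then ?w s else 0) = poly (pderiv (e \<rho>' s)) 0"
        by (auto simp: e_def pderiv_pCons)
      finally show ?thesis by simp
    qed
    have "\<rho>(s := a) \<in> S \<rightarrow> {..<n}" using \<rho> ab by auto
    from sum_delta[OF this, of ?w]
    show "(\<Sum>\<rho>'\<in>S \<rightarrow>\<^sub>E {..<n}. c \<rho>' * (poly (\<Prod>s\<in>S - {s}. e \<rho>' s) 0 * poly (pderiv (e \<rho>' s)) 0)) =
      (if \<rho> s = b then c (\<rho>(s := a)) else 0)"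
      unfolding * by (simp only: w) simp
  qed
  also have "\<dots> = (\<Sum>s\<in>{s\<in>S. \<rho> s = b}. c (\<rho>(s := a)))"
    using finS by (simp add: sum.inter_filter)
  finally show ?thesis by simp
qed

text \<open>A diagonal matrix of determinant 1 scales \<open>c \<rho>\<close> by a product of its
  entries. If \<open>c \<rho>\<close> is nonzero, any two values below n therefore occur equally
  often in \<open>\<rho>\<close>.\<close>

lemma balanced:
  assumes a: "a < n" and \<rho>: "\<rho> \<in> S \<rightarrow> {..<n}"
  shows "of_nat n * (of_nat (card {s\<in>S. \<rho> s = a}) * c \<rho>) = of_nat (card S) * c \<rho>"
proof (cases "c \<rho> = 0")
  case False
  have eq: "card {s\<in>S. \<rho> s = b} = card {s\<in>S. \<rho> s = a}" if b: "b < n" for b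
  proof (cases "a = b")
    case ab: False
    \<comment> \<open>The entries 2 at \<open>a\<close> and 1/2 at \<open>b\<close> scale
      \<open>c \<rho>\<close> by a power of 2 whose exponent is the difference of the two
      counts.\<close>
    define w where "w = (\<lambda>i. (if i = a then 2 else 1) * (if i = b then 1/2 else 1) :: complex)"
    define G where "G = mat n n (\<lambda>(i,j). if i = j then w i else 0)"
    have "det G = prod_list (diag_mat G)"
      by (rule det_upper_triangular[of _ n]) (auto simp: G_def)
    also have "diag_mat G = map w [0..<n]" by (auto simp: G_def diag_mat_def)
    also have "prod_list \<dots> = (\<Prod>i\<in>{0..<n}. w i)"
      by (metis distinct_upt prod.distinct_set_conv_list set_upt)
    also have "\<dots> = 1" using a b unfolding w_def prod.distrib by simp
    finally have "G \<in> SL n" by (simp add: SL_def G_def)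
    from SL_inv[OF this \<rho>]
    have "c \<rho> = (\<Sum>\<rho>'\<in>S \<rightarrow>\<^sub>E {..<n}. c \<rho>' * (\<Prod>s\<in>S. G $$ (\<rho>' s, \<rho> s)))" by simp
    also have "\<dots> = (\<Sum>\<rho>'\<in>S \<rightarrow>\<^sub>E {..<n}. c \<rho>' * (\<Prod>s\<in>S. if \<rho>' s = \<rho> s then w (\<rho> s) else 0))"
      using \<rho> by (intro sum.cong arg_cong2[where f = "(*)"] prod.cong refl)
        (auto simp: G_def Pi_iff PiE_iff)
    also have "\<dots> = c \<rho> * (\<Prod>s\<in>S. w (\<rho> s))" by (rule sum_delta[OF \<rho>])
    also have "(\<Prod>s\<in>S. w (\<rho> s)) = 2 ^ card {s\<in>S. \<rho> s = a} * (1/2) ^ card {s\<in>S. \<rho> s = b}"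
      unfolding w_def prod.distrib using finS by (simp add: prod.If_cases Int_def)
    finally have "(2::complex) ^ card {s\<in>S. \<rho> s = b} = 2 ^ card {s\<in>S. \<rho> s = a}"
      using False by (simp add: field_simps)
    then have "of_nat (2 ^ card {s\<in>S. \<rho> s = b}) = (of_nat (2 ^ card {s\<in>S. \<rho> s = a}) :: complex)"
      by simp
    then show ?thesis by (simp only: of_nat_eq_iff) simp
  qed simp
  have "card S = (\<Sum>s\<in>S. \<Sum>b<n. if \<rho> s = b then 1 else 0)"
    using \<rho> by (simp add: Pi_iff)
  also have "\<dots> = (\<Sum>b<n. card {s\<in>S. \<rho> s = b})"
    using finS by (subst sum.swap) (simp add: sum.If_cases Int_def)
  also have "\<dots> = n * card {s\<in>S. \<rho> s = a}" using eq by simp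
  finally show ?thesis by (metis mult.assoc of_nat_mult)
qed simp

text \<open>Write \<open>e\<^sub>a\<^sub>b\<close> for the derivation that replaces an index \<open>b\<close> by \<open>a\<close>. Invariance makes
  \<open>e\<^sub>a\<^sub>b\<close> act by 0 for \<open>a \<noteq> b\<close> and by \<open>card S / n\<close> for \<open>a = b\<close>; apply this to \<open>e\<^sub>b\<^sub>a\<close> at
  \<open>\<rho>(s := a)\<close> with \<open>b = \<rho> s\<close> and sum over \<open>a\<close>. The positions \<open>t \<noteq> s\<close> contribute the
  Jucys-Murphy element at \<open>s\<close>.\<close>

lemma Jucys_Murphy:
  assumes s: "s \<in> S" and \<rho>: "\<rho> \<in> S \<rightarrow> {..<n}"
  shows "of_nat n * (of_nat n * c \<rho> + (\<Sum>t\<in>S - {s}. c (\<rho> \<circ> transpose s t))) = of_nat (card S) * c \<rho>"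
proof -
  \<comment> \<open>\<open>?F a t\<close> is the contribution of position \<open>t\<close> when an
    index \<open>a\<close> of \<open>\<rho>(s := a)\<close> is replaced by \<open>\<rho> s\<close>.
    Summed over \<open>t\<close>, it is a multiple of \<open>c \<rho>\<close> for
    \<open>a = \<rho> s\<close> and 0 for every other \<open>a\<close>, by
    \<open>transvection\<close>.\<close>
  let ?F = "\<lambda>a t. if (\<rho>(s := a)) t = a then c (\<rho>(s := a, t := \<rho> s)) else 0"
  have sn: "\<rho> s < n" using s \<rho> by auto
  have "(\<Sum>t\<in>S. ?F a t) = (if a = \<rho> s then of_nat (card {t\<in>S. \<rho> t = \<rho> s}) * c \<rho> else 0)"
    if a: "a < n" for a
  proof (cases "a = \<rho> s")
    case True
    have "(\<Sum>t\<in>S. ?F a t) = (\<Sum>t\<in>S. if \<rho> t = \<rho> s then c \<rho> else 0)"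
      by (intro sum.cong if_cong refl) (auto simp: True intro!: coeff_cong)
    then show ?thesis using finS True by (simp add: sum.If_cases Int_def)
  next
    case False
    have "\<rho>(s := a) \<in> S \<rightarrow> {..<n}" using \<rho> a by auto
    from transvection[OF sn a _ this] False finS show ?thesis
      by (simp add: sum.inter_filter)
  qed
  then have "(\<Sum>a<n. \<Sum>t\<in>S. ?F a t) = of_nat (card {t\<in>S. \<rho> t = \<rho> s}) * c \<rho>"
    using sn by simp
  moreover have "(\<Sum>a<n. \<Sum>t\<in>S. ?F a t) = of_nat n * c \<rho> + (\<Sum>t\<in>S - {s}. c (\<rho> \<circ> transpose s t))"
  proof -
    have "(\<Sum>a<n. \<Sum>t\<in>S. ?F a t) = (\<Sum>t\<in>S. \<Sum>a<n. ?F a t)" by (rule sum.swap)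
    also have "\<dots> = (\<Sum>a<n. ?F a s) + (\<Sum>t\<in>S - {s}. \<Sum>a<n. ?F a t)"
      using s finS by (rule sum.remove[rotated])
    \<comment> \<open>At \<open>t = s\<close> the second update restores \<open>\<rho>\<close>,
      whatever \<open>a\<close> is.\<close>
    also have "(\<Sum>a<n. ?F a s) = of_nat n * c \<rho>" by simp
    also have "(\<Sum>t\<in>S - {s}. \<Sum>a<n. ?F a t) = (\<Sum>t\<in>S - {s}. c (\<rho> \<circ> transpose s t))"
    proof (rule sum.cong[OF refl])
      fix t assume t: "t \<in> S - {s}"
      \<comment> \<open>Only \<open>a = \<rho> t\<close> survives, and then the two updates exchange
        the values at \<open>s\<close> and \<open>t\<close>.\<close>
      then have "(\<Sum>a<n. ?F a t) = (\<Sum>a<n. if a = \<rho> t then c (\<rho>(s := a, t := \<rho> s)) else 0)"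
        by (intro sum.cong) auto
      also have "\<dots> = c (\<rho>(s := \<rho> t, t := \<rho> s))" using t \<rho> by auto
      also have "\<dots> = c (\<rho> \<circ> transpose s t)"
        by (rule coeff_cong) (auto simp: transpose_def)
      finally show "(\<Sum>a<n. ?F a t) = c (\<rho> \<circ> transpose s t)" .
    qed
    finally show ?thesis .
  qed
  ultimately show ?thesis using balanced[OF sn \<rho>] by simp
qed

end

text \<open>Transposing rows and transposing columns differ by a transposition of both, which changes the
  sign of the alternating sum: adding the two Jucys-Murphy identities cancels the transpositions.\<close>

lemma alternating_sum_eq_0:
  fixes d :: "(nat \<Rightarrow> nat) \<Rightarrow> (nat \<Rightarrow> nat) \<Rightarrow> complex"
  assumes rows: "\<And>\<gamma>. \<gamma> \<in> S \<rightarrow> {..<n} \<Longrightarrow> SL_tensor n S (\<lambda>\<rho>. d \<rho> \<gamma>)"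
    and cols: "\<And>\<rho>. \<rho> \<in> S \<rightarrow> {..<n} \<Longrightarrow> SL_tensor n S (d \<rho>)"
    and fin: "finite S" and card: "0 < card S" "card S < n\<^sup>2"
    and \<rho>: "\<rho> \<in> S \<rightarrow> {..<n}" and \<gamma>: "\<gamma> \<in> S \<rightarrow> {..<n}"
  shows "(\<Sum>\<pi> | \<pi> permutes S. signof \<pi> * d (\<rho> \<circ> \<pi>) (\<gamma> \<circ> \<pi>)) = 0"
proof -
  define \<Phi> where "\<Phi> = (\<Sum>\<pi> | \<pi> permutes S. signof \<pi> * d (\<rho> \<circ> \<pi>) (\<gamma> \<circ> \<pi>))"
  from card fin obtain s where s: "s \<in> S" by fastforce
  have in_S: "\<sigma> \<circ> \<pi> \<in> S \<rightarrow> {..<n}" if "\<sigma> \<in> S \<rightarrow> {..<n}" "\<pi> permutes S" for \<sigma> \<pi>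
    using that by (auto simp: permutes_in_image)
  have swap: "(\<Sum>\<pi> | \<pi> permutes S. signof \<pi> * d (\<rho> \<circ> \<pi> \<circ> transpose s t) (\<gamma> \<circ> \<pi>)) =
    - (\<Sum>\<pi> | \<pi> permutes S. signof \<pi> * d (\<rho> \<circ> \<pi>) (\<gamma> \<circ> \<pi> \<circ> transpose s t))"
    if t: "t \<in> S - {s}" for t
  proof -
    have "(transpose s t) permutes S" using s t by (intro permutes_swap_id) auto
    \<comment> \<open>Composing the summation index with \<open>transpose s t\<close> cancels the
      transposition of the rows, creates one of the columns and flips the sign.\<close>
    then have "(\<Sum>\<pi> | \<pi> permutes S. signof \<pi> * d (\<rho> \<circ> \<pi> \<circ> transpose s t) (\<gamma> \<circ> \<pi>)) =
      (\<Sum>\<pi> | \<pi> permutes S. signof (\<pi> \<circ> transpose s t) *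
        d (\<rho> \<circ> (\<pi> \<circ> transpose s t) \<circ> transpose s t) (\<gamma> \<circ> (\<pi> \<circ> transpose s t)))"
      by (rule sum_permutations_compose_right)
    also have "\<dots> = (\<Sum>\<pi> | \<pi> permutes S. - (signof \<pi> * d (\<rho> \<circ> \<pi>) (\<gamma> \<circ> \<pi> \<circ> transpose s t)))"
    proof (rule sum.cong[OF refl])
      fix \<pi> assume "\<pi> \<in> {\<pi>. \<pi> permutes S}"
      then have "permutation \<pi>" using fin permutation_permutes by auto
      then have "sign (\<pi> \<circ> transpose s t) = - sign \<pi>"
        using t by (simp add: sign_compose permutation_swap_id sign_swap_id)
      then show "signof (\<pi> \<circ> transpose s t) *
          d (\<rho> \<circ> (\<pi> \<circ> transpose s t) \<circ> transpose s t) (\<gamma> \<circ> (\<pi> \<circ> transpose s t)) =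
        - (signof \<pi> * d (\<rho> \<circ> \<pi>) (\<gamma> \<circ> \<pi> \<circ> transpose s t))"
        by (simp add: o_assoc[symmetric])
    qed
    finally show ?thesis by (simp add: sum_negf)
  qed
  define X where "X = (\<Sum>t\<in>S - {s}. \<Sum>\<pi> | \<pi> permutes S. signof \<pi> * d (\<rho> \<circ> \<pi> \<circ> transpose s t) (\<gamma> \<circ> \<pi>))"
  define Y where "Y = (\<Sum>t\<in>S - {s}. \<Sum>\<pi> | \<pi> permutes S. signof \<pi> * d (\<rho> \<circ> \<pi>) (\<gamma> \<circ> \<pi> \<circ> transpose s t))"
  have X': "X = (\<Sum>\<pi> | \<pi> permutes S. signof \<pi> * (\<Sum>t\<in>S - {s}. d (\<rho> \<circ> \<pi> \<circ> transpose s t) (\<gamma> \<circ> \<pi>)))"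
    unfolding X_def sum_distrib_left by (rule sum.swap)
  have Y': "Y = (\<Sum>\<pi> | \<pi> permutes S. signof \<pi> * (\<Sum>t\<in>S - {s}. d (\<rho> \<circ> \<pi>) (\<gamma> \<circ> \<pi> \<circ> transpose s t)))"
    unfolding Y_def sum_distrib_left by (rule sum.swap)
  have XY: "X = - Y" unfolding X_def Y_def using swap by (simp add: sum_negf)
  have "of_nat (card S) * \<Phi> = (\<Sum>\<pi> | \<pi> permutes S. signof \<pi> * (of_nat (card S) * d (\<rho> \<circ> \<pi>) (\<gamma> \<circ> \<pi>)))"
    unfolding \<Phi>_def sum_distrib_left by (simp add: ac_simps)
  also have "\<dots> = (\<Sum>\<pi> | \<pi> permutes S. signof \<pi> * (of_nat n * (of_nat n * d (\<rho> \<circ> \<pi>) (\<gamma> \<circ> \<pi>) +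
      (\<Sum>t\<in>S - {s}. d (\<rho> \<circ> \<pi> \<circ> transpose s t) (\<gamma> \<circ> \<pi>)))))"
    using SL_tensor.Jucys_Murphy[OF rows s] in_S \<rho> \<gamma> by (intro sum.cong) auto
  also have "\<dots> = of_nat n * (of_nat n * \<Phi> + X)"
    unfolding \<Phi>_def X' by (simp add: sum_distrib_left sum.distrib algebra_simps)
  finally have 1: "of_nat (card S) * \<Phi> = of_nat n * (of_nat n * \<Phi> + X)" .
  have "of_nat (card S) * \<Phi> = (\<Sum>\<pi> | \<pi> permutes S. signof \<pi> * (of_nat (card S) * d (\<rho> \<circ> \<pi>) (\<gamma> \<circ> \<pi>)))"
    unfolding \<Phi>_def sum_distrib_left by (simp add: ac_simps)
  also have "\<dots> = (\<Sum>\<pi> | \<pi> permutes S. signof \<pi> * (of_nat n * (of_nat n * d (\<rho> \<circ> \<pi>) (\<gamma> \<circ> \<pi>) +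
      (\<Sum>t\<in>S - {s}. d (\<rho> \<circ> \<pi>) (\<gamma> \<circ> \<pi> \<circ> transpose s t)))))"
    using SL_tensor.Jucys_Murphy[OF cols s] in_S \<rho> \<gamma> by (intro sum.cong) auto
  also have "\<dots> = of_nat n * (of_nat n * \<Phi> + Y)"
    unfolding \<Phi>_def Y' by (simp add: sum_distrib_left sum.distrib algebra_simps)
  finally have 2: "of_nat (card S) * \<Phi> = of_nat n * (of_nat n * \<Phi> + Y)" .
  \<comment> \<open>Since \<open>X = - Y\<close>, adding the identities \<open>1\<close> and
    \<open>2\<close> leaves only multiples of \<open>\<Phi>\<close>;
    \<open>card S < n\<^sup>2\<close> then forces \<open>\<Phi> = 0\<close>.\<close>
  have "of_nat (card S) * \<Phi> = of_nat (n\<^sup>2) * \<Phi>"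
    using 1 2 unfolding XY by (simp add: algebra_simps power2_eq_square)
  then have "\<Phi> = 0" using card(2) by (metis mult_right_cancel nat_neq_iff of_nat_eq_iff)
  then show ?thesis unfolding \<Phi>_def .
qed

section \<open>Multilinear coefficients of an invariant\<close>

text \<open>The exponent of a squarefree monomial that is linear in each matrix of \<open>S\<close>
  and free of all others. For fixed \<open>S\<close>, its coefficients in a polynomial form a tensor
  with row indices \<open>\<rho>\<close> and column indices \<open>\<gamma>\<close>.\<close>

definition multilin_monom :: "nat set \<Rightarrow> (nat \<Rightarrow> nat) \<Rightarrow> (nat \<Rightarrow> nat) \<Rightarrow> (nat \<times> nat \<times> nat) \<Rightarrow>\<^sub>0 nat" where
  "multilin_monom S \<rho> \<gamma> = (\<Sum>s\<in>S. Poly_Mapping.single (s, \<rho> s, \<gamma> s) 1)"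

abbreviation multilin_coeff ::
  "(nat \<times> nat \<times> nat) cpoly \<Rightarrow> nat set \<Rightarrow> (nat \<Rightarrow> nat) \<Rightarrow> (nat \<Rightarrow> nat) \<Rightarrow> complex" where
  "multilin_coeff p S \<rho> \<gamma> \<equiv> Poly_Mapping.lookup p (multilin_monom S \<rho> \<gamma>)"

lemma lookup_multilin_monom:
  assumes "finite S"
  shows "Poly_Mapping.lookup (multilin_monom S \<rho> \<gamma>) (s, i, j) =
    (if s \<in> S \<and> \<rho> s = i \<and> \<gamma> s = j then 1 else 0)"
proof -
  have "Poly_Mapping.lookup (multilin_monom S \<rho> \<gamma>) (s, i, j) =
      (\<Sum>t\<in>S. if t = s then (if \<rho> s = i \<and> \<gamma> s = j then 1 else 0) else 0)"
    unfolding multilin_monom_def lookup_sum lookup_single by (intro sum.cong) (auto simp: when_def)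
  then show ?thesis using assms by (simp add: sum.delta)
qed

lemma keys_multilin_monom: "finite S \<Longrightarrow> Poly_Mapping.keys (multilin_monom S \<rho> \<gamma>) =
    (\<lambda>s. (s, \<rho> s, \<gamma> s)) ` S"
  by (auto simp: in_keys_iff lookup_multilin_monom split: if_splits)

lemma multilin_monom_cong: "(\<And>s. s \<in> S \<Longrightarrow> \<rho> s = \<rho>' s \<and> \<gamma> s = \<gamma>' s) \<Longrightarrow> multilin_monom S \<rho> \<gamma> =
    multilin_monom S \<rho>' \<gamma>'"
  unfolding multilin_monom_def by (intro sum.cong) auto

lemma multilin_monom_eq_iff:
  assumes "finite S"
  shows "multilin_monom S \<rho> \<gamma> = multilin_monom S \<rho>' \<gamma>' \<longleftrightarrow> (\<forall>s\<in>S. \<rho> s = \<rho>' s \<and> \<gamma> s = \<gamma>' s)"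
proof
  assume eq: "multilin_monom S \<rho> \<gamma> = multilin_monom S \<rho>' \<gamma>'"
  show "\<forall>s\<in>S. \<rho> s = \<rho>' s \<and> \<gamma> s = \<gamma>' s"
  proof
    fix s assume "s \<in> S"
    then have "Poly_Mapping.lookup (multilin_monom S \<rho>' \<gamma>') (s, \<rho> s, \<gamma> s) = 1"
      unfolding eq[symmetric] lookup_multilin_monom[OF assms] by simp
    then show "\<rho> s = \<rho>' s \<and> \<gamma> s = \<gamma>' s"
      unfolding lookup_multilin_monom[OF assms] by (auto split: if_splits)
  qed
qed (auto intro: multilin_monom_cong)

lemma multilin_monom_split:
  "finite S \<Longrightarrow> T \<subseteq> S \<Longrightarrow> multilin_monom S \<rho> \<gamma> = multilin_monom T \<rho> \<gamma> + multilin_monom (S - T) \<rho> \<gamma>"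
  unfolding multilin_monom_def by (simp add: sum.subset_diff[of T S] add.commute)

lemma prod_keys_multilin_monom:
  fixes \<xi> :: "nat \<times> nat \<times> nat \<Rightarrow> complex"
  assumes "finite S"
  shows "(\<Prod>v\<in>Poly_Mapping.keys (multilin_monom S \<rho> \<gamma>).
      \<xi> v ^ Poly_Mapping.lookup (multilin_monom S \<rho> \<gamma>) v) = (\<Prod>s\<in>S. \<xi> (s, \<rho> s, \<gamma> s))"
  unfolding keys_multilin_monom[OF assms]
  by (subst prod.reindex) (auto simp: inj_on_def lookup_multilin_monom assms)

lemma mdegree_multilin_monom: "finite S \<Longrightarrow> mdegree (multilin_monom S \<rho> \<gamma>) = card S"
  unfolding mdegree_def keys_multilin_monom
  by (subst sum.reindex) (auto simp: inj_on_def lookup_multilin_monom)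

text \<open>Each matrix of \<open>S\<close> contributes at least one variable, and the degree leaves
  room for only one each, with exponent 1.\<close>

lemma multilin_monom_of_mdegree:
  assumes S: "fst ` Poly_Mapping.keys t = S" and deg: "mdegree t = card S"
  shows "\<exists>\<rho> \<gamma>. t = multilin_monom S \<rho> \<gamma>"
proof -
  let ?K = "Poly_Mapping.keys t"
  have "\<forall>s\<in>S. \<exists>v\<in>?K. fst v = s" using S by auto
  then obtain v where v: "\<And>s. s \<in> S \<Longrightarrow> v s \<in> ?K" "\<And>s. s \<in> S \<Longrightarrow> fst (v s) = s" by metis
  have finS: "finite S" using S by auto
  have card: "card ?K = card S"
  proof (rule antisym)
    show "card S \<le> card ?K" using S card_image_le[of ?K fst] by simp
    have "card ?K = (\<Sum>u\<in>?K. 1)" by simp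
    also have "\<dots> \<le> mdegree t" unfolding mdegree_def
      by (rule sum_mono) (simp add: in_keys_iff)
    finally show "card ?K \<le> card S" using deg by simp
  qed
  have one: "Poly_Mapping.lookup t u = 1" if u: "u \<in> ?K" for u
  proof -
    have "(\<Sum>u\<in>?K. Poly_Mapping.lookup t u - 1) = mdegree t - card ?K"
      unfolding mdegree_def by (subst sum_subtractf_nat) (auto simp: in_keys_iff)
    then have "(\<Sum>u\<in>?K. Poly_Mapping.lookup t u - 1) = 0" using card deg by simp
    then have "Poly_Mapping.lookup t u \<le> 1" using u by simp
    then show ?thesis using u by (simp add: in_keys_iff)
  qed
  have "inj_on v S" using v(2) by (metis inj_on_inverseI)
  then have "v ` S = ?K" using v(1) card by (intro card_subset_eq) (auto simp: card_image)
  moreover have "(\<lambda>s. (s, fst (snd (v s)), snd (snd (v s)))) ` S = v ` S"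
    using v(2) by (intro image_cong) (auto simp: prod_eq_iff)
  ultimately have keys: "Poly_Mapping.keys (multilin_monom S (fst \<circ> snd \<circ> v) (snd \<circ> snd \<circ> v)) = ?K"
    using keys_multilin_monom[OF finS] by simp
  have "t = multilin_monom S (fst \<circ> snd \<circ> v) (snd \<circ> snd \<circ> v)"
  proof (rule poly_mapping_eqI)
    fix u
    show "Poly_Mapping.lookup t u =
      Poly_Mapping.lookup (multilin_monom S (fst \<circ> snd \<circ> v) (snd \<circ> snd \<circ> v)) u"
    proof (cases "u \<in> ?K")
      case True
      then have "Poly_Mapping.lookup (multilin_monom S (fst \<circ> snd \<circ> v) (snd \<circ> snd \<circ> v)) u \<noteq> 0"
        by (simp only: keys in_keys_iff[symmetric])
      then show ?thesis using one[OF True]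
        by (cases u) (auto simp: lookup_multilin_monom finS split: if_splits)
    next
      case False
      then show ?thesis using keys by (metis in_keys_iff)
    qed
  qed
  then show ?thesis by blast
qed

definition zero_outside :: "nat \<Rightarrow> nat \<Rightarrow> nat set \<Rightarrow> (nat \<Rightarrow> complex mat) \<Rightarrow> complex mat list" where
  "zero_outside n m S X = map (\<lambda>s. if s \<in> S then X s else 0\<^sub>m n n) [0..<m]"

text \<open>Inclusion-exclusion over the matrices set to zero keeps the monomials that involve every
  matrix with index in \<open>S\<close>; in degree \<open>card S\<close> these are the multilinear ones.\<close>

lemma multilinear_part:
  assumes p: "p \<in> Mat_poly_ring n m" and hom: "homogeneous (card S) p" and S: "S \<subseteq> {..<m}"
  shows "(\<Sum>U\<in>Pow S. (-1) ^ card U * eval_at (zero_outside n m (S - U) X) p) =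
    (\<Sum>\<rho>\<in>S \<rightarrow>\<^sub>E {..<n}. \<Sum>\<gamma>\<in>S \<rightarrow>\<^sub>E {..<n}. multilin_coeff p S \<rho> \<gamma> * (\<Prod>s\<in>S. X s $$ (\<rho> s, \<gamma> s)))"
proof -
  have finS: "finite S" using S finite_subset by blast
  define ev where "ev = (\<lambda>t. \<Prod>v\<in>Poly_Mapping.keys t. (X (fst v) $$ snd v) ^ Poly_Mapping.lookup t v)"
  define T where "T = (\<lambda>(\<rho>, \<gamma>). multilin_monom S \<rho> \<gamma>) ` ((S \<rightarrow>\<^sub>E {..<n}) \<times> (S \<rightarrow>\<^sub>E {..<n}))"
  have finT: "finite T" unfolding T_def using finS
      by (intro finite_imageI finite_cartesian_product finite_PiE) auto
  let ?K = "Poly_Mapping.keys p"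
  have var: "fst v < m" "fst (snd v) < n" "snd (snd v) < n"
    if "t \<in> ?K" "v \<in> Poly_Mapping.keys t" for t v
    using that p unfolding Mat_poly_ring_def by fastforce+
  have ev_zero: "eval_at (zero_outside n m (S - U) X) p =
      (\<Sum>t\<in>?K. Poly_Mapping.lookup p t * (if fst ` Poly_Mapping.keys t \<subseteq> S - U then ev t else 0))" for U
    unfolding eval_at_def peval_def
  proof (intro sum.cong refl arg_cong2[where f = "(*)"])
    fix t assume t: "t \<in> ?K"
    let ?\<xi> = "\<lambda>(k, i, j). zero_outside n m (S - U) X ! k $$ (i, j)"
    have \<xi>: "?\<xi> v = (if fst v \<in> S - U then X (fst v) $$ snd v else 0)"
      if "v \<in> Poly_Mapping.keys t" for v
      using var[OF t that] by (auto simp: zero_outside_def split: prod.splits)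
    show "(\<Prod>v\<in>Poly_Mapping.keys t. ?\<xi> v ^ Poly_Mapping.lookup t v) =
      (if fst ` Poly_Mapping.keys t \<subseteq> S - U then ev t else 0)"
    proof (cases "fst ` Poly_Mapping.keys t \<subseteq> S - U")
      case True
      have "?\<xi> v = X (fst v) $$ snd v" if v: "v \<in> Poly_Mapping.keys t" for v
      proof -
        have "fst v \<in> S - U" using True v by blast
        then show ?thesis unfolding \<xi>[OF v] by (simp only: if_True)
      qed
      then have "(\<Prod>v\<in>Poly_Mapping.keys t. ?\<xi> v ^ Poly_Mapping.lookup t v) = ev t"
        unfolding ev_def by (intro prod.cong[OF refl]) (simp only:)
      then show ?thesis by (simp only: True if_True)
    next
      case False
      then obtain v where v: "v \<in> Poly_Mapping.keys t" "fst v \<notin> S - U" by auto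
      then have "?\<xi> v ^ Poly_Mapping.lookup t v = 0" by (simp only: \<xi>) (simp add: in_keys_iff)
      then show ?thesis using v False by (subst prod_zero) auto
    qed
  qed
  have incl_excl: "(\<Sum>U\<in>Pow S. (-1) ^ card U * (if F \<subseteq> S - U then z else 0)) = (if F = S then z else 0)"
    for F and z :: complex
  proof (cases "F \<subseteq> S")
    case True
    \<comment> \<open>Since \<open>?y\<close> vanishes exactly on \<open>F\<close>, the product of
      \<open>- ?y s\<close> over \<open>U\<close> is \<open>(-1) ^ card U\<close> if
      \<open>U\<close> avoids \<open>F\<close> and 0 otherwise. The sum over \<open>U\<close> is
      then the expansion of the product of all \<open>1 - ?y s\<close>.\<close>
    let ?y = "\<lambda>s. if s \<in> F then 0 else 1 :: complex"
    have "(\<Sum>U\<in>Pow S. (-1) ^ card U * (if F \<subseteq> S - U then z else 0)) =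
      (\<Sum>U\<in>Pow S. (\<Prod>s\<in>U. - ?y s) * (\<Prod>s\<in>S - U. 1)) * z"
      unfolding sum_distrib_right
    proof (rule sum.cong[OF refl])
      fix U assume "U \<in> Pow S"
      then have U: "U \<subseteq> S" "finite U" using finS finite_subset by auto
      show "(-1) ^ card U * (if F \<subseteq> S - U then z else 0) = (\<Prod>s\<in>U. - ?y s) * (\<Prod>s\<in>S - U. 1) * z"
      proof (cases "F \<inter> U = {}")
        case True
        then have "(\<Prod>s\<in>U. - ?y s) = (\<Prod>s\<in>U. - 1)" by (intro prod.cong) auto
        then show ?thesis using True \<open>F \<subseteq> S\<close> by auto
      next
        case False
        then have "(\<Prod>s\<in>U. - ?y s) = 0" using U by (intro prod_zero) auto
        then show ?thesis using False by auto
      qed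
    qed
    also have "\<dots> = (\<Prod>s\<in>S. - ?y s + 1) * z" by (simp only: prod_add[OF finS])
    also have "(\<Prod>s\<in>S. - ?y s + 1) = (if F = S then 1 else 0)"
      using True finS by (auto intro!: prod.neutral)
    finally show ?thesis by simp
  next
    case False
    then have "\<not> F \<subseteq> S - U" for U by blast
    then show ?thesis using False by auto
  qed
  have "(\<Sum>U\<in>Pow S. (-1) ^ card U * eval_at (zero_outside n m (S - U) X) p) =
    (\<Sum>t\<in>?K. \<Sum>U\<in>Pow S. Poly_Mapping.lookup p t *
        ((-1) ^ card U * (if fst ` Poly_Mapping.keys t \<subseteq> S - U then ev t else 0)))"
    unfolding ev_zero sum_distrib_left by (subst sum.swap) (simp only: ac_simps)
  also have "\<dots> = (\<Sum>t\<in>?K. Poly_Mapping.lookup p t * (if fst ` Poly_Mapping.keys t = S then ev t else 0))"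
    unfolding sum_distrib_left[symmetric] incl_excl ..
  \<comment> \<open>A monomial of \<open>p\<close> that involves exactly the matrices of
    \<open>S\<close> has degree \<open>card S\<close>, so it is multilinear and lies in
    \<open>T\<close>; members of \<open>T\<close> that do not occur in \<open>p\<close> have
    coefficient 0.\<close>
  also have "\<dots> = (\<Sum>t\<in>T. Poly_Mapping.lookup p t * ev t)"
  proof (rule sum.mono_neutral_cong)
    show "finite ?K" "finite T" using finT by auto
    show "Poly_Mapping.lookup p t * ev t = 0" if "t \<in> T - ?K" for t
      using that by (auto simp: in_keys_iff)
    show "Poly_Mapping.lookup p t * (if fst ` Poly_Mapping.keys t = S then ev t else 0) = 0"
      if t: "t \<in> ?K - T" for t
    proof -
      have "t \<in> T" if F: "fst ` Poly_Mapping.keys t = S"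
      proof -
        have "mdegree t = card S" using t hom by (auto simp: homogeneous_def)
        from multilin_monom_of_mdegree[OF F this] obtain \<rho> \<gamma> where mon: "t = multilin_monom S \<rho> \<gamma>"
            by blast
        have "\<rho> s < n" "\<gamma> s < n" if "s \<in> S" for s
          using var[of t "(s, \<rho> s, \<gamma> s)"] t that by (auto simp: mon keys_multilin_monom finS)
        then have "(restrict \<rho> S, restrict \<gamma> S) \<in> (S \<rightarrow>\<^sub>E {..<n}) \<times> (S \<rightarrow>\<^sub>E {..<n})" by auto
        moreover have "t = multilin_monom S (restrict \<rho> S) (restrict \<gamma> S)"
          unfolding mon by (rule multilin_monom_cong) auto
        ultimately show ?thesis unfolding T_def by force
      qed
      then show ?thesis using t by auto
    qed
    show "Poly_Mapping.lookup p t * (if fst ` Poly_Mapping.keys t = S then ev t else 0) =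
        Poly_Mapping.lookup p t * ev t"
      if "t \<in> ?K \<inter> T" for t
      using that unfolding T_def by (auto simp: keys_multilin_monom finS image_image)
  qed
  also have "\<dots> = (\<Sum>(\<rho>, \<gamma>)\<in>(S \<rightarrow>\<^sub>E {..<n}) \<times> (S \<rightarrow>\<^sub>E {..<n}). multilin_coeff p S \<rho> \<gamma> *
      ev (multilin_monom S \<rho> \<gamma>))"
  proof -
    have "inj_on (\<lambda>(\<rho>, \<gamma>). multilin_monom S \<rho> \<gamma>) ((S \<rightarrow>\<^sub>E {..<n}) \<times> (S \<rightarrow>\<^sub>E {..<n}))"
    proof (rule inj_onI, clarify)
      fix \<rho> \<gamma> \<rho>' \<gamma>'
      assume PiE: "\<rho> \<in> S \<rightarrow>\<^sub>E {..<n}" "\<gamma> \<in> S \<rightarrow>\<^sub>E {..<n}" "\<rho>' \<in> S \<rightarrow>\<^sub>E {..<n}" "\<gamma>' \<in> S \<rightarrow>\<^sub>E {..<n}"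
        and "multilin_monom S \<rho> \<gamma> = multilin_monom S \<rho>' \<gamma>'"
      then have eq: "\<rho> s = \<rho>' s" "\<gamma> s = \<gamma>' s" if "s \<in> S" for s
        using that multilin_monom_eq_iff[OF finS] by auto
      show "\<rho> = \<rho>' \<and> \<gamma> = \<gamma>'"
        using PiE_ext[OF PiE(1,3) eq(1)] PiE_ext[OF PiE(2,4) eq(2)] by blast
    qed
    then show ?thesis unfolding T_def by (subst sum.reindex) (auto intro!: sum.cong)
  qed
  also have "\<dots> = (\<Sum>\<rho>\<in>S \<rightarrow>\<^sub>E {..<n}. \<Sum>\<gamma>\<in>S \<rightarrow>\<^sub>E {..<n}. multilin_coeff p S \<rho> \<gamma> * (\<Prod>s\<in>S. X s $$ (\<rho> s, \<gamma> s)))"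
    unfolding sum.cartesian_product ev_def
    by (intro sum.cong refl) (auto simp: prod_keys_multilin_monom[OF finS])
  finally show ?thesis .
qed

section \<open>Invariance of the multilinear coefficients under SL_n x SL_n\<close>

lemma SL_inverse:
  assumes "B \<in> SL n"
  shows "the (mat_inverse B) \<in> SL n" "B * the (mat_inverse B) = 1\<^sub>m n"
proof -
  have B: "B \<in> carrier_mat n n" "det B = 1" using assms by (auto simp: SL_def)
  then obtain C where C: "mat_inverse B = Some C"
    using mat_inverse(1)[OF B(1)] det_non_zero_imp_unit[OF B(1)] by fastforce
  from mat_inverse(2)[OF B(1) C] have *: "B * C = 1\<^sub>m n" "C \<in> carrier_mat n n" by auto
  have "det B * det C = 1" using det_mult[OF B(1) *(2)] *(1) by simp
  then show "the (mat_inverse B) \<in> SL n" "B * the (mat_inverse B) = 1\<^sub>m n"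
    using C * B by (auto simp: SL_def)
qed

text \<open>If \<open>B * C\<close> and \<open>C * D\<close> are both the identity, then
  \<open>D = (B * C) * D = B * (C * D) = B\<close>. Hence every \<open>G\<close> in
  \<open>SL n\<close> occurs as the right factor in \<open>act\<close>.\<close>

lemma SL_inverse_inverse:
  assumes "B \<in> SL n"
  shows "the (mat_inverse (the (mat_inverse B))) = B"
proof -
  define C where "C = the (mat_inverse B)"
  define D where "D = the (mat_inverse C)"
  have C: "C \<in> SL n" "B * C = 1\<^sub>m n" using SL_inverse[OF assms] by (auto simp: C_def)
  have D: "D \<in> SL n" "C * D = 1\<^sub>m n" using SL_inverse[OF C(1)] by (auto simp: D_def)
  have car: "B \<in> carrier_mat n n" "C \<in> carrier_mat n n" "D \<in> carrier_mat n n"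
    using assms C D by (auto simp: SL_def)
  have "D = (B * C) * D" using C car by simp
  also have "\<dots> = B * (C * D)" using car by (intro assoc_mult_mat)
  also have "\<dots> = B" using D car by simp
  finally show ?thesis unfolding D_def C_def .
qed

lemma one_in_SL: "1\<^sub>m n \<in> SL n"
  by (simp add: SL_def)

lemma transpose_in_SL: "G \<in> SL n \<Longrightarrow> transpose_mat G \<in> SL n"
  by (auto simp: SL_def det_transpose)

lemma act_zero_outside:
  assumes "A \<in> SL n" "B \<in> SL n"
  shows "act (A, B) (zero_outside n m S X) =
    zero_outside n m S (\<lambda>s. A * X s * the (mat_inverse B))"
proof -
  have "A \<in> carrier_mat n n" "the (mat_inverse B) \<in> carrier_mat n n"
    using assms SL_inverse(1)[of B n] by (auto simp: SL_def)
  then have "A * 0\<^sub>m n n * the (mat_inverse B) = 0\<^sub>m n n" by simp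
  then show ?thesis unfolding act_def zero_outside_def by auto
qed

text \<open>Invariance is evaluated at a tuple of matrix units: before the action the multilinear
  part is a single coefficient, after it a combination of coefficients with weights from
  \<open>A\<close> and \<open>G\<close>.\<close>

lemma SL_SL_coeff:
  assumes p: "p \<in> R n m" and hom: "homogeneous (card S) p" and S: "S \<subseteq> {..<m}"
    and AG: "A \<in> SL n" "G \<in> SL n" and \<rho>: "\<rho> \<in> S \<rightarrow> {..<n}" and \<gamma>: "\<gamma> \<in> S \<rightarrow> {..<n}"
  shows "(\<Sum>\<rho>'\<in>S \<rightarrow>\<^sub>E {..<n}. \<Sum>\<gamma>'\<in>S \<rightarrow>\<^sub>E {..<n}. multilin_coeff p S \<rho>' \<gamma>' *
    (\<Prod>s\<in>S. A $$ (\<rho>' s, \<rho> s) * G $$ (\<gamma> s, \<gamma>' s))) = multilin_coeff p S \<rho> \<gamma>"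
proof -
  have finS: "finite S" using S finite_subset by blast
  have pM: "p \<in> Mat_poly_ring n m" using p by (simp add: R_def)
  define B where "B = the (mat_inverse G)"
  have B: "B \<in> SL n" "the (mat_inverse B) = G"
    unfolding B_def using SL_inverse[OF AG(2)] SL_inverse_inverse[OF AG(2)] by auto
  have car: "A \<in> carrier_mat n n" "G \<in> carrier_mat n n" using AG by (auto simp: SL_def)
  define E where "E = (\<lambda>s. mat n n (\<lambda>(i, j). if i = \<rho> s \<and> j = \<gamma> s then 1 else 0) :: complex mat)"
  define M where "M = (\<lambda>X. \<Sum>U\<in>Pow S. (-1) ^ card U * eval_at (zero_outside n m (S - U) X) p)"
  have AEG: "(A * E s * G) $$ (i, j) = A $$ (i, \<rho> s) * G $$ (\<gamma> s, j)"
    if "s \<in> S" "i < n" "j < n" for s i j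
  proof -
    have n: "\<rho> s < n" "\<gamma> s < n" using that \<rho> \<gamma> by auto
    have AE: "(A * E s) $$ (i, k) = (if k = \<gamma> s then A $$ (i, \<rho> s) else 0)" if k: "k < n" for k
    proof -
      have "(A * E s) $$ (i, k) = (\<Sum>l\<in>{0..<n}. A $$ (i, l) * (if l = \<rho> s \<and> k = \<gamma> s then 1 else 0))"
        using car k \<open>i < n\<close> by (auto simp: E_def scalar_prod_def)
      also have "\<dots> = (\<Sum>l\<in>{0..<n}. if l = \<rho> s then (if k = \<gamma> s then A $$ (i, \<rho> s) else 0) else 0)"
        by (intro sum.cong) auto
      finally show ?thesis using n by simp
    qed
    have "A * E s \<in> carrier_mat n n" using car by (auto simp: E_def)
    then have "(A * E s * G) $$ (i, j) = (\<Sum>k\<in>{0..<n}. (A * E s) $$ (i, k) * G $$ (k, j))"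
      using car that by (auto simp: scalar_prod_def)
    also have "\<dots> = (\<Sum>k\<in>{0..<n}. if k = \<gamma> s then A $$ (i, \<rho> s) * G $$ (\<gamma> s, j) else 0)"
      by (intro sum.cong) (auto simp: AE)
    finally show ?thesis using n by simp
  qed
  \<comment> \<open>Setting matrices to zero commutes with the action, so each term of the
    inclusion-exclusion sum is invariant by itself.\<close>
  have inv: "eval_at (zero_outside n m U (\<lambda>s. A * E s * G)) p = eval_at (zero_outside n m U E) p" for U
  proof -
    have "zero_outside n m U E \<in> Mat_tuples n m"
      by (auto simp: zero_outside_def Mat_tuples_def E_def)
    then show ?thesis using p AG B act_zero_outside[OF AG(1) B(1), of m U E]
      unfolding R_def by force
  qed
  have "(\<Sum>\<rho>'\<in>S \<rightarrow>\<^sub>E {..<n}. \<Sum>\<gamma>'\<in>S \<rightarrow>\<^sub>E {..<n}. multilin_coeff p S \<rho>' \<gamma>' *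
      (\<Prod>s\<in>S. A $$ (\<rho>' s, \<rho> s) * G $$ (\<gamma> s, \<gamma>' s))) = M (\<lambda>s. A * E s * G)"
    unfolding M_def multilinear_part[OF pM hom S]
  proof (intro sum.cong refl arg_cong2[where f = "(*)"] prod.cong)
    fix \<rho>' \<gamma>' s assume "\<rho>' \<in> S \<rightarrow>\<^sub>E {..<n}" "\<gamma>' \<in> S \<rightarrow>\<^sub>E {..<n}" "s \<in> S"
    then have "\<rho>' s < n" "\<gamma>' s < n" "s \<in> S" by auto
    then show "A $$ (\<rho>' s, \<rho> s) * G $$ (\<gamma> s, \<gamma>' s) = (A * E s * G) $$ (\<rho>' s, \<gamma>' s)"
      using AEG by simp
  qed
  also have "\<dots> = M E" unfolding M_def inv ..
  also have "\<dots> = (\<Sum>\<rho>'\<in>S \<rightarrow>\<^sub>E {..<n}. \<Sum>\<gamma>'\<in>S \<rightarrow>\<^sub>E {..<n}.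
      (multilin_coeff p S \<rho>' \<gamma>' * (\<Prod>s\<in>S. if \<rho>' s = \<rho> s then 1 else 0)) *
      (\<Prod>s\<in>S. if \<gamma>' s = \<gamma> s then 1 else 0))"
    unfolding M_def multilinear_part[OF pM hom S] mult.assoc prod.distrib[symmetric]
  proof (intro sum.cong refl arg_cong2[where f = "(*)"] prod.cong)
    fix \<rho>' \<gamma>' s assume "\<rho>' \<in> S \<rightarrow>\<^sub>E {..<n}" "\<gamma>' \<in> S \<rightarrow>\<^sub>E {..<n}" "s \<in> S"
    then have "\<rho>' s < n" "\<gamma>' s < n" "s \<in> S" by auto
    then show "E s $$ (\<rho>' s, \<gamma>' s) = (if \<rho>' s = \<rho> s then 1 else 0) * (if \<gamma>' s = \<gamma> s then 1 else 0)"
      by (simp add: E_def)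
  qed
  also have "\<dots> = multilin_coeff p S (restrict \<rho> S) (restrict \<gamma> S)"
    by (simp only: sum_PiE_delta[OF finS _ \<gamma>] sum_PiE_delta[OF finS _ \<rho>] finite_lessThan
        prod.neutral_const mult_1_right)
  also have "multilin_monom S (restrict \<rho> S) (restrict \<gamma> S) = multilin_monom S \<rho> \<gamma>"
    by (rule multilin_monom_cong) auto
  finally show ?thesis .
qed

text \<open>With the identity as right factor the column indices stay fixed and only the action on
  row indices remains.\<close>

lemma SL_tensor_rows:
  assumes p: "p \<in> R n m" and hom: "homogeneous (card S) p" and S: "S \<subseteq> {..<m}"
    and \<gamma>: "\<gamma> \<in> S \<rightarrow> {..<n}"
  shows "SL_tensor n S (\<lambda>\<rho>. multilin_coeff p S \<rho> \<gamma>)"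
proof
  show finS: "finite S" using S finite_subset by blast
  show "multilin_coeff p S \<rho> \<gamma> = multilin_coeff p S \<rho>' \<gamma>"
    if "\<And>s. s \<in> S \<Longrightarrow> \<rho> s = \<rho>' s" for \<rho> \<rho>'
    using that by (intro arg_cong[where f = "Poly_Mapping.lookup p"] multilin_monom_cong) auto
  fix G \<rho> assume G: "G \<in> SL n" and \<rho>: "\<rho> \<in> S \<rightarrow> {..<n}"
  have "multilin_coeff p S \<rho> \<gamma> = (\<Sum>\<rho>'\<in>S \<rightarrow>\<^sub>E {..<n}. \<Sum>\<gamma>'\<in>S \<rightarrow>\<^sub>E {..<n}.
      (multilin_coeff p S \<rho>' \<gamma>' * (\<Prod>s\<in>S. G $$ (\<rho>' s, \<rho> s))) *
      (\<Prod>s\<in>S. if \<gamma>' s = \<gamma> s then 1 else 0))"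
    unfolding SL_SL_coeff[OF p hom S G one_in_SL \<rho> \<gamma>, symmetric] mult.assoc prod.distrib[symmetric]
    using \<gamma> by (intro sum.cong refl arg_cong2[where f = "(*)"] prod.cong) (auto simp: PiE_iff Pi_iff)
  also have "\<dots> = (\<Sum>\<rho>'\<in>S \<rightarrow>\<^sub>E {..<n}. multilin_coeff p S \<rho>' (restrict \<gamma> S) * (\<Prod>s\<in>S. G $$ (\<rho>' s, \<rho> s)))"
    by (simp only: sum_PiE_delta[OF finS _ \<gamma>] finite_lessThan prod.neutral_const mult_1_right)
  moreover have "multilin_monom S \<rho>' (restrict \<gamma> S) = multilin_monom S \<rho>' \<gamma>" for \<rho>'
    by (rule multilin_monom_cong) auto
  ultimately show "(\<Sum>\<rho>'\<in>S \<rightarrow>\<^sub>E {..<n}. multilin_coeff p S \<rho>' \<gamma> * (\<Prod>s\<in>S. G $$ (\<rho>' s, \<rho> s))) =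
    multilin_coeff p S \<rho> \<gamma>" by simp
qed

text \<open>The mirror image, with the identity on the left. Right multiplication puts
  \<open>\<gamma>\<close> in the row index of its matrix, so the transpose of \<open>G\<close> is
  inserted to match \<open>SL_tensor\<close>.\<close>

lemma SL_tensor_cols:
  assumes p: "p \<in> R n m" and hom: "homogeneous (card S) p" and S: "S \<subseteq> {..<m}"
    and \<rho>: "\<rho> \<in> S \<rightarrow> {..<n}"
  shows "SL_tensor n S (\<lambda>\<gamma>. multilin_coeff p S \<rho> \<gamma>)"
proof
  show finS: "finite S" using S finite_subset by blast
  show "multilin_coeff p S \<rho> \<gamma> = multilin_coeff p S \<rho> \<gamma>'"
    if "\<And>s. s \<in> S \<Longrightarrow> \<gamma> s = \<gamma>' s" for \<gamma> \<gamma>'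
    using that by (intro arg_cong[where f = "Poly_Mapping.lookup p"] multilin_monom_cong) auto
  fix G \<gamma> assume G: "G \<in> SL n" and \<gamma>: "\<gamma> \<in> S \<rightarrow> {..<n}"
  have GT: "transpose_mat G $$ (i, j) = G $$ (j, i)" if "i < n" "j < n" for i j
    using that G by (auto simp: SL_def)
  have "multilin_coeff p S \<rho> \<gamma> = (\<Sum>\<rho>'\<in>S \<rightarrow>\<^sub>E {..<n}.
      (\<Sum>\<gamma>'\<in>S \<rightarrow>\<^sub>E {..<n}. multilin_coeff p S \<rho>' \<gamma>' * (\<Prod>s\<in>S. G $$ (\<gamma>' s, \<gamma> s))) *
      (\<Prod>s\<in>S. if \<rho>' s = \<rho> s then 1 else 0))"
    unfolding SL_SL_coeff[OF p hom S one_in_SL transpose_in_SL[OF G] \<rho> \<gamma>, symmetric]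
      sum_distrib_right mult.assoc prod.distrib[symmetric]
    using \<gamma> \<rho> by (intro sum.cong refl, intro arg_cong[where f = "(*) _"] prod.cong)
      (auto simp: PiE_iff Pi_iff GT)
  also have "\<dots> = (\<Sum>\<gamma>'\<in>S \<rightarrow>\<^sub>E {..<n}. multilin_coeff p S (restrict \<rho> S) \<gamma>' * (\<Prod>s\<in>S. G $$ (\<gamma>' s, \<gamma> s)))"
    by (simp only: sum_PiE_delta[OF finS _ \<rho>] finite_lessThan prod.neutral_const mult_1_right)
  also have "multilin_monom S (restrict \<rho> S) = multilin_monom S \<rho>"
    by (intro ext multilin_monom_cong) auto
  finally show "(\<Sum>\<gamma>'\<in>S \<rightarrow>\<^sub>E {..<n}. multilin_coeff p S \<rho> \<gamma>' * (\<Prod>s\<in>S. G $$ (\<gamma>' s, \<gamma> s))) =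
    multilin_coeff p S \<rho> \<gamma>" by simp
qed

section \<open>Determinants of Kronecker products\<close>

lemma sum_div_mod:
  fixes g :: "nat \<Rightarrow> nat \<Rightarrow> 'a :: comm_monoid_add"
  shows "(\<Sum>v<n * n. g (v div n) (v mod n)) = (\<Sum>a<n. \<Sum>b<n. g a b)"
proof -
  have "(\<Sum>v<n * n. g (v div n) (v mod n)) = (\<Sum>(a, b)\<in>{..<n} \<times> {..<n}. g a b)"
  proof (rule sum.reindex_bij_witness[where i = "\<lambda>(a, b). a * n + b" and j = "\<lambda>v. (v div n, v mod n)"])
    fix v assume "v \<in> {..<n * n}"
    then have "v < n * n" "0 < n" by (auto intro: Nat.gr0I)
    then show "(v div n, v mod n) \<in> {..<n} \<times> {..<n}"
      by (auto simp: less_mult_imp_div_less)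
  next
    fix ab assume "ab \<in> {..<n} \<times> {..<n}"
    then obtain a b where ab: "ab = (a, b)" "a < n" "b < n" by auto
    have "Suc a * n \<le> n * n" using ab by (intro mult_le_mono1) auto
    then show "(case ab of (a, b) \<Rightarrow> a * n + b) \<in> {..<n * n}" using ab by simp
  qed auto
  then show ?thesis by (simp add: sum.cartesian_product)
qed

lemma prod_div:
  fixes g :: "nat \<Rightarrow> 'a :: comm_semiring_1"
  shows "(\<Prod>v<n * k. g (v div n)) = (\<Prod>a<k. g a ^ n)"
proof (cases "n = 0")
  case False
  show ?thesis
  proof (induction k)
    case (Suc k)
    have "(\<Prod>v<n * Suc k. g (v div n)) = (\<Prod>v<n * k. g (v div n)) * (\<Prod>v\<in>{n * k..<n * k + n}. g (v div n))"
      by (simp add: lessThan_atLeast0 prod.atLeastLessThan_concat add.commute)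
    also have "(\<Prod>v\<in>{n * k..<n * k + n}. g (v div n)) = (\<Prod>v\<in>{n * k..<n * k + n}. g k)"
    proof (intro prod.cong refl arg_cong[where f = g])
      fix v assume "v \<in> {n * k..<n * k + n}"
      then show "v div n = k"
        using False by (intro div_nat_eqI) (auto simp: algebra_simps)
    qed
    finally show ?case using Suc by simp
  qed simp
qed simp

lemma prod_mod:
  fixes g :: "nat \<Rightarrow> 'a :: comm_semiring_1"
  shows "(\<Prod>v<n * k. g (v mod n)) = (\<Prod>b<n. g b) ^ k"
proof (induction k)
  case (Suc k)
  have "(\<Prod>v<n * Suc k. g (v mod n)) = (\<Prod>v<n * k. g (v mod n)) *
      (\<Prod>v\<in>{0 + n * k..<n + n * k}. g (v mod n))"
    by (simp add: lessThan_atLeast0 prod.atLeastLessThan_concat add.commute)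
  also have "(\<Prod>v\<in>{0 + n * k..<n + n * k}. g (v mod n)) = (\<Prod>v\<in>{0..<n}. g v)"
    unfolding prod.shift_bounds_nat_ivl by (intro prod.cong) auto
  finally show ?case using Suc by (simp add: lessThan_atLeast0 mult.commute)
qed simp

definition kron :: "nat \<Rightarrow> complex mat \<Rightarrow> complex mat \<Rightarrow> complex mat" where
  "kron n A B = mat (n * n) (n * n) (\<lambda>(u, v). A $$ (u div n, v div n) * B $$ (u mod n, v mod n))"

lemma kron_carrier [simp]: "kron n A B \<in> carrier_mat (n * n) (n * n)"
  by (simp add: kron_def)

lemma div_mod_bounds:
  fixes n :: nat
  assumes "u < n * n"
  shows "u div n < n" "u mod n < n"
  using assms by (auto simp: less_mult_imp_div_less intro!: mod_less_divisor intro: Nat.gr0I)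

lemma kron_mult:
  assumes "A \<in> carrier_mat n n" "B \<in> carrier_mat n n" "C \<in> carrier_mat n n" "D \<in> carrier_mat n n"
  shows "kron n A B * kron n C D = kron n (A * C) (B * D)"
proof (rule eq_matI)
  fix u v assume "u < dim_row (kron n (A * C) (B * D))" "v < dim_col (kron n (A * C) (B * D))"
  then have uv: "u < n * n" "v < n * n" by (auto simp: kron_def)
  note b = div_mod_bounds[OF uv(1)] div_mod_bounds[OF uv(2)]
  have "(kron n A B * kron n C D) $$ (u, v) = (\<Sum>w<n * n. kron n A B $$ (u, w) * kron n C D $$ (w, v))"
    using uv by (simp add: kron_def scalar_prod_def lessThan_atLeast0)
  also have "\<dots> = (\<Sum>w<n * n. A $$ (u div n, w div n) * B $$ (u mod n, w mod n) *
      (C $$ (w div n, v div n) * D $$ (w mod n, v mod n)))"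
    using uv by (intro sum.cong) (auto simp: kron_def)
  also have "\<dots> = (\<Sum>a<n. \<Sum>b<n. A $$ (u div n, a) * B $$ (u mod n, b) *
      (C $$ (a, v div n) * D $$ (b, v mod n)))"
    by (rule sum_div_mod)
  also have "\<dots> = (\<Sum>a<n. A $$ (u div n, a) * C $$ (a, v div n)) *
      (\<Sum>b<n. B $$ (u mod n, b) * D $$ (b, v mod n))"
    by (simp add: sum_product ac_simps)
  also have "\<dots> = kron n (A * C) (B * D) $$ (u, v)"
    using uv b assms by (simp add: kron_def scalar_prod_def lessThan_atLeast0)
  finally show "(kron n A B * kron n C D) $$ (u, v) = kron n (A * C) (B * D) $$ (u, v)" .
qed (auto simp: kron_def)

lemma kron_one: "kron n (1\<^sub>m n) (1\<^sub>m n) = 1\<^sub>m (n * n)"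
proof (rule eq_matI)
  fix u v assume "u < dim_row (1\<^sub>m (n * n))" "v < dim_col (1\<^sub>m (n * n))"
  then have uv: "u < n * n" "v < n * n" by auto
  have "u = v" if "u div n = v div n" "u mod n = v mod n"
    using that by (metis div_mult_mod_eq)
  then show "kron n (1\<^sub>m n) (1\<^sub>m n) $$ (u, v) = (1\<^sub>m (n * n) :: complex mat) $$ (u, v)"
    using uv div_mod_bounds[OF uv(1)] div_mod_bounds[OF uv(2)] by (auto simp: kron_def)
qed (auto simp: kron_def)

lemma det_eq_prod_diag:
  assumes "upper_triangular A" "A \<in> carrier_mat k k"
  shows "det A = (\<Prod>i<k. A $$ (i, i))"
proof -
  have "det A = prod_list (map (\<lambda>i. A $$ (i, i)) [0..<k])"
    using det_upper_triangular[OF assms] assms(2) by (simp add: diag_mat_def)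
  then show ?thesis
    by (simp add: prod.distinct_set_conv_list[symmetric] lessThan_atLeast0)
qed

text \<open>The encoding of pairs is lexicographic, so below the diagonal of the product one of the
  two factors lies below its own diagonal. On the diagonal each entry of \<open>A\<close> and of
  \<open>B\<close> occurs n times.\<close>

lemma det_kron_upper_triangular:
  assumes A: "A \<in> carrier_mat n n" "upper_triangular A" and B: "B \<in> carrier_mat n n" "upper_triangular B"
  shows "det (kron n A B) = det A ^ n * det B ^ n"
proof -
  have "upper_triangular (kron n A B)"
    unfolding upper_triangular_def
  proof (intro allI impI)
    fix u v assume "u < dim_row (kron n A B)" and vu: "v < u"
    then have uv: "u < n * n" "v < n * n" by (auto simp: kron_def)
    note b = div_mod_bounds[OF uv(1)] div_mod_bounds[OF uv(2)]
    have "v div n \<le> u div n" using vu by (intro div_le_mono) auto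
    moreover have "v mod n < u mod n" if "v div n = u div n"
      using vu that by (metis div_mult_mod_eq nat_add_left_cancel_less)
    ultimately consider "v div n < u div n" | "v mod n < u mod n" by linarith
    then have "A $$ (u div n, v div n) = 0 \<or> B $$ (u mod n, v mod n) = 0"
    proof cases
      case 1
      then show ?thesis using upper_triangularD[OF A(2) 1] b A(1) by auto
    next
      case 2
      then show ?thesis using upper_triangularD[OF B(2) 2] b B(1) by auto
    qed
    then show "kron n A B $$ (u, v) = 0" using uv by (auto simp: kron_def)
  qed
  then have "det (kron n A B) = (\<Prod>u<n * n. kron n A B $$ (u, u))"
    by (rule det_eq_prod_diag) simp
  also have "\<dots> = (\<Prod>u<n * n. A $$ (u div n, u div n)) * (\<Prod>u<n * n. B $$ (u mod n, u mod n))"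
    unfolding prod.distrib[symmetric] by (intro prod.cong) (auto simp: kron_def)
  also have "\<dots> = (\<Prod>i<n. A $$ (i, i)) ^ n * (\<Prod>i<n. B $$ (i, i)) ^ n"
    by (simp add: prod_div[of "\<lambda>i. A $$ (i, i)"] prod_mod[of "\<lambda>i. B $$ (i, i)"] prod_power_distrib)
  finally show ?thesis using A B by (simp add: det_eq_prod_diag)
qed

text \<open>Over the complex numbers the characteristic polynomial splits, so a Schur decomposition
  exists.\<close>

lemma triangularize:
  fixes A :: "complex mat"
  assumes "A \<in> carrier_mat n n"
  shows "\<exists>P T Q. {P, T, Q} \<subseteq> carrier_mat n n \<and> P * Q = 1\<^sub>m n \<and> A = P * T * Q \<and> upper_triangular T \<and>
      det T = det A"
proof -
  obtain es where es: "char_poly A = (\<Prod>e\<leftarrow>es. [:- e, 1:])"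
    using char_poly_factorized[OF assms] by blast
  obtain T where T: "upper_triangular T" "similar_mat A T"
    using schur_decomposition_exists[OF assms es] by blast
  from similar_matD[OF T(2)] obtain k P Q where
    *: "{A, T, P, Q} \<subseteq> carrier_mat k k" "P * Q = 1\<^sub>m k" "A = P * T * Q" by blast
  moreover have "k = n" using * assms by auto
  ultimately show ?thesis using T(1) det_similar[OF T(2)]
    by (intro exI[of _ P] exI[of _ T] exI[of _ Q]) simp
qed

text \<open>Multiplicativity of \<open>kron\<close> makes \<open>kron n A B\<close> conjugate to
  \<open>kron n T T'\<close>, which reduces the claim to triangular matrices.\<close>

lemma det_kron:
  assumes A: "A \<in> carrier_mat n n" and B: "B \<in> carrier_mat n n"
  shows "det (kron n A B) = det A ^ n * det B ^ n"
proof -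
  obtain P T Q where A': "{P, T, Q} \<subseteq> carrier_mat n n" "P * Q = 1\<^sub>m n" "A = P * T * Q"
    "upper_triangular T" "det T = det A" using triangularize[OF A] by (elim exE conjE) (rule that)
  obtain P' T' Q' where B': "{P', T', Q'} \<subseteq> carrier_mat n n" "P' * Q' = 1\<^sub>m n" "B = P' * T' * Q'"
    "upper_triangular T'" "det T' = det B" using triangularize[OF B] by (elim exE conjE) (rule that)
  have car: "P * T \<in> carrier_mat n n" "P' * T' \<in> carrier_mat n n"
    using A'(1) B'(1) by (auto intro: mult_carrier_mat)
  have "kron n P P' * kron n T T' = kron n (P * T) (P' * T')"
    using A'(1) B'(1) by (intro kron_mult) auto
  moreover have "kron n (P * T) (P' * T') * kron n Q Q' = kron n A B"
    unfolding A'(3) B'(3) using A'(1) B'(1) car by (intro kron_mult) auto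
  ultimately have "kron n A B = kron n P P' * kron n T T' * kron n Q Q'" by simp
  then have "det (kron n A B) = det (kron n P P') * det (kron n T T') * det (kron n Q Q')"
    by (simp add: det_mult[of _ "n * n"] mult_carrier_mat[of _ "n * n" "n * n"])
  also have "\<dots> = det (kron n P P' * kron n Q Q') * det (kron n T T')"
    by (simp add: det_mult[of _ "n * n"])
  also have "kron n P P' * kron n Q Q' = 1\<^sub>m (n * n)"
    using A' B' by (simp add: kron_mult kron_one)
  finally show ?thesis using A' B' by (simp add: det_kron_upper_triangular)
qed

section \<open>Alternating coefficients\<close>

text \<open>The index \<open>u < n * n\<close> encodes the matrix position \<open>(u div n, u mod n)\<close>.\<close>

abbreviation perm_monom :: "nat \<Rightarrow> nat set \<Rightarrow> (nat \<Rightarrow> nat) \<Rightarrow> (nat \<times> nat \<times> nat) \<Rightarrow>\<^sub>0 nat" where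
  "perm_monom n S \<sigma> \<equiv> multilin_monom S (\<lambda>s. \<sigma> s div n) (\<lambda>s. \<sigma> s mod n)"

text \<open>The linear functional that separates the determinant from multiples of invariants of
  lower positive degree. It sees only monomials with one entry from each of the first n^2 matrices,
  in pairwise distinct positions.\<close>

definition alt_coeff :: "nat \<Rightarrow> (nat \<times> nat \<times> nat) cpoly \<Rightarrow> complex" where
  "alt_coeff n p = (\<Sum>\<sigma> | \<sigma> permutes {..<n * n}. signof \<sigma> *
      Poly_Mapping.lookup p (perm_monom n {..<n * n} \<sigma>))"

lemma alt_coeff_add: "alt_coeff n (p + q) = alt_coeff n p + alt_coeff n q"
  by (simp add: alt_coeff_def lookup_add algebra_simps sum.distrib)

lemma alt_coeff_sum: "alt_coeff n (\<Sum>i\<in>I. f i) = (\<Sum>i\<in>I. alt_coeff n (f i))"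
  unfolding alt_coeff_def lookup_sum sum_distrib_left by (rule sum.swap)

lemma sum_single_keys: "(\<Sum>t\<in>Poly_Mapping.keys p. Poly_Mapping.single t (Poly_Mapping.lookup p t)) = p"
proof (rule poly_mapping_eqI)
  fix t
  show "Poly_Mapping.lookup (\<Sum>t\<in>Poly_Mapping.keys p.
      Poly_Mapping.single t (Poly_Mapping.lookup p t)) t = Poly_Mapping.lookup p t"
    by (simp add: lookup_sum lookup_single when_def in_keys_iff)
qed

lemma lookup_times_single:
  fixes p :: "'x cpoly"
  shows "Poly_Mapping.lookup (p * Poly_Mapping.single r b) t =
    (\<Sum>l\<in>Poly_Mapping.keys p. if l + r = t then Poly_Mapping.lookup p l * b else 0)"
proof -
  have "p * Poly_Mapping.single r b =
    (\<Sum>l\<in>Poly_Mapping.keys p. Poly_Mapping.single (l + r) (Poly_Mapping.lookup p l * b))"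
    by (subst (1) sum_single_keys[symmetric]) (simp add: sum_distrib_right mult_single)
  then show ?thesis by (simp add: lookup_sum lookup_single when_def)
qed

lemma lookup_times_single_add:
  fixes p :: "'x cpoly"
  shows "Poly_Mapping.lookup (p * Poly_Mapping.single r b) (t + r) = Poly_Mapping.lookup p t * b"
  unfolding lookup_times_single by (simp add: in_keys_iff)

text \<open>The exponents of \<open>r\<close> are bounded by those of a squarefree monomial, so each
  of its variables is one of that monomial's, with exponent 1.\<close>

lemma multilin_monom_factor:
  assumes fin: "finite S" and eq: "multilin_monom S \<rho> \<gamma> = l + r"
  shows "fst ` Poly_Mapping.keys r \<subseteq> S" "r = multilin_monom (fst ` Poly_Mapping.keys r) \<rho> \<gamma>"
proof -
  have le: "Poly_Mapping.lookup r v \<le> Poly_Mapping.lookup (multilin_monom S \<rho> \<gamma>) v" for v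
    by (simp add: eq lookup_add)
  have keys: "s \<in> S \<and> \<rho> s = i \<and> \<gamma> s = j \<and> Poly_Mapping.lookup r (s, i, j) = 1"
    if "(s, i, j) \<in> Poly_Mapping.keys r" for s i j
    using le[of "(s, i, j)"] that by (auto simp: lookup_multilin_monom fin in_keys_iff split: if_splits)
  then show sub: "fst ` Poly_Mapping.keys r \<subseteq> S" by auto
  show "r = multilin_monom (fst ` Poly_Mapping.keys r) \<rho> \<gamma>"
  proof (rule poly_mapping_eqI)
    fix v :: "nat \<times> nat \<times> nat"
    obtain s i j where v: "v = (s, i, j)" by (cases v) auto
    have "s \<in> fst ` Poly_Mapping.keys r \<and> \<rho> s = i \<and> \<gamma> s = j \<longleftrightarrow> (s, i, j) \<in> Poly_Mapping.keys r"
      using keys by force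
    then show "Poly_Mapping.lookup r v =
        Poly_Mapping.lookup (multilin_monom (fst ` Poly_Mapping.keys r) \<rho> \<gamma>) v"
      unfolding v using keys[of s i j] by (auto simp: lookup_multilin_monom in_keys_iff)
  qed
qed

text \<open>A monomial \<open>r\<close> fixes the values of \<open>\<sigma>\<close> outside the set \<open>S\<close> of matrices that do not occur
  in it, so antisymmetrising over the permutations of \<open>S\<close> only affects the factor \<open>p\<close>.\<close>

lemma alt_coeff_times_single:
  assumes p: "p \<in> R n m" and hom: "homogeneous k p" and k: "0 < k" "k < n\<^sup>2" and m: "n\<^sup>2 \<le> m"
  shows "alt_coeff n (p * Poly_Mapping.single r b) = 0"
proof -
  let ?N = "{..<n * n}"
  define S where "S = ?N - fst ` Poly_Mapping.keys r"
  have SN: "S \<subseteq> ?N" and finS: "finite S" by (auto simp: S_def)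
  \<comment> \<open>\<open>Q \<sigma>\<close> says that \<open>r\<close> is the part of the monomial
    of \<open>\<sigma>\<close> outside \<open>S\<close>. For any other \<open>\<sigma>\<close>,
    \<open>r\<close> does not divide that monomial and the coefficient is 0.\<close>
  define Q where "Q = (\<lambda>\<sigma>. r = perm_monom n (?N - S) \<sigma>)"
  have lookup: "Poly_Mapping.lookup (p * Poly_Mapping.single r b) (perm_monom n ?N \<sigma>) =
    (if Q \<sigma> then Poly_Mapping.lookup p (perm_monom n S \<sigma>) * b else 0)" for \<sigma>
  proof (cases "Q \<sigma>")
    case True
    then have "perm_monom n ?N \<sigma> = perm_monom n S \<sigma> + r"
      unfolding Q_def using multilin_monom_split[OF _ SN] by auto
    then show ?thesis using True lookup_times_single_add by metis
  next
    case False
    have "perm_monom n ?N \<sigma> \<noteq> l + r" for l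
    proof
      assume "perm_monom n ?N \<sigma> = l + r"
      from multilin_monom_factor[OF finite_lessThan this] False show False
        unfolding Q_def S_def by (simp add: double_diff)
    qed
    then have "l + r \<noteq> perm_monom n ?N \<sigma>" for l by metis
    then show ?thesis using False by (simp add: lookup_times_single)
  qed
  have alt_coeff: "alt_coeff n (p * Poly_Mapping.single r b) =
    (\<Sum>\<sigma> | \<sigma> permutes ?N. if Q \<sigma> then signof \<sigma> * (Poly_Mapping.lookup p (perm_monom n S \<sigma>) * b) else 0)"
    unfolding alt_coeff_def lookup by (intro sum.cong) auto
  show ?thesis
  proof (cases "card S = k")
    \<comment> \<open>The remaining factor has degree \<open>card S\<close>, while \<open>p\<close>
      is homogeneous of the different degree \<open>k\<close>.\<close>
    case False
    have "Poly_Mapping.lookup p (perm_monom n S \<sigma>) = 0" for \<sigma>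
      using hom False mdegree_multilin_monom[OF finS]
      unfolding homogeneous_def by (metis in_keys_iff)
    then show ?thesis unfolding alt_coeff by (intro sum.neutral) auto
  next
    case True
    have Sm: "S \<subseteq> {..<m}" using SN m by (auto simp: power2_eq_square)
    have hom': "homogeneous (card S) p" using hom True by simp
    \<comment> \<open>One copy of the sum is taken for each permutation \<open>\<pi>\<close> of
      \<open>S\<close>, and in that copy \<open>\<sigma>\<close> is replaced by
      \<open>\<sigma> \<circ> \<pi>\<close>. The number of copies is nonzero, so it suffices that
      the total vanishes.\<close>
    have "of_nat (card {\<pi>. \<pi> permutes S}) * alt_coeff n (p * Poly_Mapping.single r b) =
      (\<Sum>\<pi> | \<pi> permutes S. \<Sum>\<sigma> | \<sigma> permutes ?N.
          if Q \<sigma> then signof \<sigma> * (Poly_Mapping.lookup p (perm_monom n S \<sigma>) * b) else 0)"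
      unfolding alt_coeff by simp
    also have "\<dots> = (\<Sum>\<pi> | \<pi> permutes S. \<Sum>\<sigma> | \<sigma> permutes ?N. if Q \<sigma> then
        signof \<sigma> * (signof \<pi> * Poly_Mapping.lookup p (perm_monom n S (\<sigma> \<circ> \<pi>)) * b) else 0)"
    proof (rule sum.cong[OF refl])
      fix \<pi> assume "\<pi> \<in> {\<pi>. \<pi> permutes S}"
      then have \<pi>: "\<pi> permutes S" "\<pi> permutes ?N" using permutes_subset[OF _ SN] by auto
      \<comment> \<open>\<open>\<pi>\<close> fixes every index outside \<open>S\<close>, and
        \<open>Q\<close> depends on no others.\<close>
      have Q: "Q (\<sigma> \<circ> \<pi>) = Q \<sigma>" for \<sigma>
      proof -
        have "perm_monom n (?N - S) (\<sigma> \<circ> \<pi>) = perm_monom n (?N - S) \<sigma>"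
          by (rule multilin_monom_cong) (simp add: permutes_not_in[OF \<pi>(1)])
        then show ?thesis by (simp add: Q_def)
      qed
      have "(\<Sum>\<sigma> | \<sigma> permutes ?N. if Q \<sigma> then signof \<sigma> * (Poly_Mapping.lookup p (perm_monom n S \<sigma>) * b)
          else 0) =
        (\<Sum>\<sigma> | \<sigma> permutes ?N. if Q (\<sigma> \<circ> \<pi>) then
          signof (\<sigma> \<circ> \<pi>) * (Poly_Mapping.lookup p (perm_monom n S (\<sigma> \<circ> \<pi>)) * b) else 0)"
        by (rule sum_permutations_compose_right[OF \<pi>(2)])
      also have "\<dots> = (\<Sum>\<sigma> | \<sigma> permutes ?N. if Q \<sigma> then
          signof \<sigma> * (signof \<pi> * Poly_Mapping.lookup p (perm_monom n S (\<sigma> \<circ> \<pi>)) * b) else 0)"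
      proof (rule sum.cong[OF refl])
        fix \<sigma> assume "\<sigma> \<in> {\<sigma>. \<sigma> permutes ?N}"
        then have "permutation \<sigma>" "permutation \<pi>" using \<pi> permutation_permutes by blast+
        then have "sign (\<sigma> \<circ> \<pi>) = sign \<sigma> * sign \<pi>" by (rule sign_compose)
        then show "(if Q (\<sigma> \<circ> \<pi>) then signof (\<sigma> \<circ> \<pi>) *
            (Poly_Mapping.lookup p (perm_monom n S (\<sigma> \<circ> \<pi>)) * b) else 0) =
          (if Q \<sigma> then signof \<sigma> * (signof \<pi> * Poly_Mapping.lookup p
              (perm_monom n S (\<sigma> \<circ> \<pi>)) * b) else 0)"
          unfolding Q by simp
      qed
      finally show "(\<Sum>\<sigma> | \<sigma> permutes ?N. if Q \<sigma>
          then signof \<sigma> * (Poly_Mapping.lookup p (perm_monom n S \<sigma>) * b) else 0) =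
        (\<Sum>\<sigma> | \<sigma> permutes ?N. if Q \<sigma> then
          signof \<sigma> * (signof \<pi> * Poly_Mapping.lookup p (perm_monom n S (\<sigma> \<circ> \<pi>)) * b) else 0)" .
    qed
    also have "\<dots> = (\<Sum>\<sigma> | \<sigma> permutes ?N. \<Sum>\<pi> | \<pi> permutes S. if Q \<sigma> then
        signof \<sigma> * (signof \<pi> * Poly_Mapping.lookup p (perm_monom n S (\<sigma> \<circ> \<pi>)) * b) else 0)"
      by (rule sum.swap)
    also have "\<dots> = 0"
    proof (rule sum.neutral, intro ballI)
      fix \<sigma> assume "\<sigma> \<in> {\<sigma>. \<sigma> permutes ?N}"
      then have "\<sigma> s < n * n" if "s \<in> S" for s
        using that SN permutes_in_image[of \<sigma> ?N s] by auto
      then have \<rho>\<gamma>: "(\<lambda>s. \<sigma> s div n) \<in> S \<rightarrow> {..<n}" "(\<lambda>s. \<sigma> s mod n) \<in> S \<rightarrow> {..<n}"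
        using div_mod_bounds by auto
      \<comment> \<open>For fixed \<open>\<sigma>\<close> this is the alternating sum of the tensor
        of \<open>p\<close> on \<open>S\<close>, where \<open>card S = k\<close> lies strictly
        between 0 and n^2.\<close>
      have "(\<Sum>\<pi> | \<pi> permutes S. signof \<pi> * Poly_Mapping.lookup p (perm_monom n S (\<sigma> \<circ> \<pi>))) = 0"
        using alternating_sum_eq_0[of S n "\<lambda>\<rho> \<gamma>. multilin_coeff p S \<rho> \<gamma>",
            OF SL_tensor_rows[OF p hom' Sm] SL_tensor_cols[OF p hom' Sm] finS _ _ \<rho>\<gamma>] k True
        by (simp add: o_def)
      then have "(\<Sum>\<pi> | \<pi> permutes S. signof \<sigma> *
          (signof \<pi> * Poly_Mapping.lookup p (perm_monom n S (\<sigma> \<circ> \<pi>)) * b)) = 0"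
        by (simp add: sum_distrib_left[symmetric] sum_distrib_right[symmetric])
      then show "(\<Sum>\<pi> | \<pi> permutes S. if Q \<sigma> then
        signof \<sigma> * (signof \<pi> * Poly_Mapping.lookup p (perm_monom n S (\<sigma> \<circ> \<pi>)) * b) else 0) = 0"
        by (cases "Q \<sigma>") (simp_all add: o_def)
    qed
    finally show ?thesis using card_permutations[OF refl finS] by simp
  qed
qed

lemma alt_coeff_times:
  assumes "p \<in> R n m" "homogeneous k p" "0 < k" "k < n\<^sup>2" "n\<^sup>2 \<le> m"
  shows "alt_coeff n (p * q) = 0"
proof -
  have "p * q = (\<Sum>r\<in>Poly_Mapping.keys q. p * Poly_Mapping.single r (Poly_Mapping.lookup q r))"
    by (simp add: sum_distrib_left[symmetric] sum_single_keys)
  then show ?thesis by (simp add: alt_coeff_sum alt_coeff_times_single[OF assms])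
qed

section \<open>The determinant as an invariant of degree n^2\<close>

definition det_poly :: "nat \<Rightarrow> (nat \<times> nat \<times> nat) cpoly" where
  "det_poly n = (\<Sum>\<sigma> | \<sigma> permutes {..<n * n}. Poly_Mapping.single (perm_monom n {..<n * n} \<sigma>) (signof \<sigma>))"

lemma perm_monom_inj: "inj_on (perm_monom n {..<n * n}) {\<sigma>. \<sigma> permutes {..<n * n}}"
proof (rule inj_onI)
  fix \<sigma> \<tau> assume perm: "\<sigma> \<in> {\<sigma>. \<sigma> permutes {..<n * n}}" "\<tau> \<in> {\<sigma>. \<sigma> permutes {..<n * n}}"
    and "perm_monom n {..<n * n} \<sigma> = perm_monom n {..<n * n} \<tau>"
  then have "\<forall>s\<in>{..<n * n}. \<sigma> s div n = \<tau> s div n \<and> \<sigma> s mod n = \<tau> s mod n"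
    by (simp only: multilin_monom_eq_iff[OF finite_lessThan])
  then have "\<sigma> s = \<tau> s" if "s < n * n" for s
    using that by (metis div_mult_mod_eq lessThan_iff)
  then show "\<sigma> = \<tau>"
    using perm permutes_not_in[of \<sigma> "{..<n * n}"] permutes_not_in[of \<tau> "{..<n * n}"]
    by (intro ext) (metis lessThan_iff mem_Collect_eq)
qed

lemma lookup_det_poly:
  assumes "\<sigma> permutes {..<n * n}"
  shows "Poly_Mapping.lookup (det_poly n) (perm_monom n {..<n * n} \<sigma>) = signof \<sigma>"
proof -
  have "Poly_Mapping.lookup (det_poly n) (perm_monom n {..<n * n} \<sigma>) =
    (\<Sum>\<tau> | \<tau> permutes {..<n * n}. if \<tau> = \<sigma> then signof \<sigma> else 0)"
    unfolding det_poly_def lookup_sum lookup_single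
    using assms inj_onD[OF perm_monom_inj] by (intro sum.cong) (auto simp: when_def)
  then show ?thesis using assms by (simp add: finite_permutations)
qed

lemma keys_det_poly: "Poly_Mapping.keys (det_poly n) \<subseteq>
    perm_monom n {..<n * n} ` {\<sigma>. \<sigma> permutes {..<n * n}}"
proof
  fix t assume "t \<in> Poly_Mapping.keys (det_poly n)"
  then have "(\<Sum>\<sigma> | \<sigma> permutes {..<n * n}.
      Poly_Mapping.lookup (Poly_Mapping.single (perm_monom n {..<n * n} \<sigma>) (signof \<sigma>)) t) \<noteq>
      (0 :: complex)"
    by (simp add: in_keys_iff det_poly_def lookup_sum)
  then obtain \<sigma> where "\<sigma> permutes {..<n * n}"
      "Poly_Mapping.lookup (Poly_Mapping.single (perm_monom n {..<n * n} \<sigma>) (signof \<sigma> :: complex)) t \<noteq> 0"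
    by (metis (mono_tags, lifting) mem_Collect_eq sum.not_neutral_contains_not_neutral)
  then show "t \<in> perm_monom n {..<n * n} ` {\<sigma>. \<sigma> permutes {..<n * n}}"
    by (auto simp: lookup_single when_def split: if_splits)
qed

text \<open>Every sign is paired with itself, so the value is the factorial of n^2.\<close>

lemma alt_coeff_det_poly: "alt_coeff n (det_poly n) \<noteq> 0"
proof -
  have "alt_coeff n (det_poly n) = (\<Sum>\<sigma> | \<sigma> permutes {..<n * n}. signof \<sigma> * signof \<sigma>)"
    unfolding alt_coeff_def by (intro sum.cong) (auto simp: lookup_det_poly)
  also have "\<dots> = of_nat (fact (n * n))"
    by (simp add: sign_idempotent card_permutations flip: of_int_mult)
  finally show ?thesis by simp
qed

definition vec_mat :: "nat \<Rightarrow> complex mat list \<Rightarrow> complex mat" where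
  "vec_mat n Xs = mat (n * n) (n * n) (\<lambda>(s, u). (Xs ! s) $$ (u div n, u mod n))"

lemma vec_mat_carrier: "vec_mat n Xs \<in> carrier_mat (n * n) (n * n)"
  by (simp add: vec_mat_def)

lemma eval_det_poly: "eval_at Xs (det_poly n) = det (vec_mat n Xs)"
proof -
  let ?N = "{..<n * n}" and ?\<xi> = "\<lambda>(k, i, j). (Xs ! k) $$ (i, j)"
  have "eval_at Xs (det_poly n) = (\<Sum>t\<in>perm_monom n ?N ` {\<sigma>. \<sigma> permutes ?N}.
      Poly_Mapping.lookup (det_poly n) t *
      (\<Prod>v\<in>Poly_Mapping.keys t. ?\<xi> v ^ Poly_Mapping.lookup t v))"
    unfolding eval_at_def peval_def
    by (rule sum.mono_neutral_left) (auto intro: keys_det_poly[THEN subsetD]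
        simp: finite_permutations in_keys_iff)
  also have "\<dots> = (\<Sum>\<sigma> | \<sigma> permutes ?N. signof \<sigma> * (\<Prod>s\<in>?N. (Xs ! s) $$ (\<sigma> s div n, \<sigma> s mod n)))"
    unfolding sum.reindex[OF perm_monom_inj] o_def
    by (intro sum.cong) (auto simp: lookup_det_poly prod_keys_multilin_monom)
  also have "\<dots> = det (vec_mat n Xs)"
    unfolding det_def'[OF vec_mat_carrier] atLeast0LessThan
  proof (intro sum.cong refl arg_cong2[where f = "(*)"] prod.cong)
    fix \<sigma> s assume "\<sigma> \<in> {\<sigma>. \<sigma> permutes ?N}" "s \<in> ?N"
    then have "\<sigma> s < n * n" "s < n * n" using permutes_in_image[of \<sigma> ?N s] by auto
    then show "(Xs ! s) $$ (\<sigma> s div n, \<sigma> s mod n) = vec_mat n Xs $$ (s, \<sigma> s)"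
      by (simp add: vec_mat_def)
  qed
  finally show ?thesis .
qed

text \<open>Each row of \<open>vec_mat\<close> is a matrix written out row by row. The entry at (k,
  l) of A X C is the sum of A_ki X_ij C_jl, which pairs the row of X with a column of the Kronecker
  product of the transpose of A with C.\<close>

lemma vec_mat_act:
  assumes AB: "A \<in> SL n" "B \<in> SL n" and Xs: "Xs \<in> Mat_tuples n m" and m: "n * n \<le> m"
  shows "vec_mat n (act (A, B) Xs) = vec_mat n Xs * kron n (transpose_mat A) (the (mat_inverse B))"
proof -
  define C where "C = the (mat_inverse B)"
  have car: "A \<in> carrier_mat n n" "C \<in> carrier_mat n n"
    using AB SL_inverse(1)[OF AB(2)] by (auto simp: SL_def C_def)
  show ?thesis unfolding C_def[symmetric]
  proof (rule eq_matI)
    fix s u assume "s < dim_row (vec_mat n Xs * kron n (transpose_mat A) C)"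
      "u < dim_col (vec_mat n Xs * kron n (transpose_mat A) C)"
    then have su: "s < n * n" "u < n * n" by (auto simp: vec_mat_def kron_def)
    note b = div_mod_bounds[OF su(2)]
    have len: "s < length Xs" using su m Xs by (auto simp: Mat_tuples_def)
    then have X: "Xs ! s \<in> carrier_mat n n" using Xs by (auto simp: Mat_tuples_def)
    have "vec_mat n (act (A, B) Xs) $$ (s, u) = (A * Xs ! s * C) $$ (u div n, u mod n)"
      using su len by (simp add: vec_mat_def act_def C_def)
    also have "\<dots> = (\<Sum>j<n. (\<Sum>i<n. A $$ (u div n, i) * (Xs ! s) $$ (i, j)) * C $$ (j, u mod n))"
      using X car b by (simp add: scalar_prod_def lessThan_atLeast0 del: assoc_mult_mat)
    also have "\<dots> = (\<Sum>i<n. \<Sum>j<n. (Xs ! s) $$ (i, j) * (A $$ (u div n, i) * C $$ (j, u mod n)))"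
      unfolding sum_distrib_right by (subst sum.swap) (simp add: ac_simps)
    also have "\<dots> = (\<Sum>v<n * n. (Xs ! s) $$ (v div n, v mod n) * (A $$ (u div n, v div n) *
        C $$ (v mod n, u mod n)))"
      by (rule sum_div_mod[symmetric])
    also have "\<dots> = (\<Sum>v<n * n. vec_mat n Xs $$ (s, v) * kron n (transpose_mat A) C $$ (v, u))"
    proof (rule sum.cong[OF refl])
      fix v assume "v \<in> {..<n * n}"
      then have v: "v < n * n" by simp
      show "(Xs ! s) $$ (v div n, v mod n) * (A $$ (u div n, v div n) * C $$ (v mod n, u mod n)) =
        vec_mat n Xs $$ (s, v) * kron n (transpose_mat A) C $$ (v, u)"
        using su v b div_mod_bounds[OF v] car by (simp add: vec_mat_def kron_def)
    qed
    also have "\<dots> = (vec_mat n Xs * kron n (transpose_mat A) C) $$ (s, u)"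
      using su by (simp add: vec_mat_def kron_def scalar_prod_def lessThan_atLeast0)
    finally show "vec_mat n (act (A, B) Xs) $$ (s, u) =
        (vec_mat n Xs * kron n (transpose_mat A) C) $$ (s, u)" .
  qed (auto simp: vec_mat_def kron_def)
qed

lemma det_poly_in_R:
  assumes m: "n\<^sup>2 \<le> m"
  shows "det_poly n \<in> R n m"
proof -
  have m': "n * n \<le> m" using m by (simp add: power2_eq_square)
  have "det_poly n \<in> Mat_poly_ring n m"
    unfolding Mat_poly_ring_def
  proof (intro CollectI ballI subsetI)
    fix t v assume "t \<in> Poly_Mapping.keys (det_poly n)" and v: "v \<in> Poly_Mapping.keys t"
    then obtain \<sigma> where \<sigma>: "\<sigma> permutes {..<n * n}" "t = perm_monom n {..<n * n} \<sigma>"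
      using keys_det_poly by blast
    then obtain s where s: "s < n * n" "v = (s, \<sigma> s div n, \<sigma> s mod n)"
      using v by (auto simp: keys_multilin_monom)
    then have "\<sigma> s < n * n" using permutes_in_image[OF \<sigma>(1), of s] by simp
    then show "v \<in> {..<m} \<times> {..<n} \<times> {..<n}" using s m' div_mod_bounds[of "\<sigma> s" n] by simp
  qed
  moreover have "eval_at (act (A, B) Xs) (det_poly n) = eval_at Xs (det_poly n)"
    if AB: "A \<in> SL n" "B \<in> SL n" and Xs: "Xs \<in> Mat_tuples n m" for A B Xs
  proof -
    have "det (kron n (transpose_mat A) (the (mat_inverse B))) = 1"
      using transpose_in_SL[OF AB(1)] SL_inverse(1)[OF AB(2)] by (simp add: SL_def det_kron)
    then show ?thesis
      unfolding eval_det_poly vec_mat_act[OF AB Xs m']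
      by (subst det_mult[of _ "n * n"]) (auto simp: vec_mat_def)
  qed
  ultimately show ?thesis by (auto simp: R_def)
qed

section \<open>Generation in degrees below n^2\<close>

text \<open>The polynomials all of whose multiples are killed by \<open>\<phi>\<close> form an
  ideal. Being constant modulo an ideal passes from generators to sums and products.\<close>

lemma generated_subalgebra_const_plus:
  assumes gen: "\<And>p. p \<in> G \<Longrightarrow> \<exists>c. \<forall>q. \<phi> ((p - Defs.const c) * q) = 0"
    and add: "\<And>p q. \<phi> (p + q) = \<phi> p + (\<phi> q :: complex)"
    and p: "p \<in> generated_subalgebra G"
  shows "\<exists>c. \<forall>q. \<phi> ((p - Defs.const c) * q) = 0"
  using p
proof induction
  case (const c)
  have "\<phi> 0 = 0" using add[of 0 0] by simp
  then show ?case by (intro exI[of _ c]) simp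
next
  case (gen p)
  then show ?case by (rule assms(1))
next
  case (add p q)
  then obtain c d where cd: "\<And>q'. \<phi> ((p - Defs.const c) * q') = 0"
    "\<And>q'. \<phi> ((q - Defs.const d) * q') = 0" by blast
  have "Defs.const (c + d) = (Defs.const c + Defs.const d :: 'a cpoly)"
      by (simp add: const_def single_add)
  then have "(p + q - Defs.const (c + d)) * q' = (p - Defs.const c) * q' + (q - Defs.const d) * q'"
      for q'
    by (simp add: algebra_simps)
  then show ?case using cd assms(2) by (intro exI[of _ "c + d"]) simp
next
  case (mult p q)
  then obtain c d where cd: "\<And>q'. \<phi> ((p - Defs.const c) * q') = 0"
    "\<And>q'. \<phi> ((q - Defs.const d) * q') = 0" by blast
  have "Defs.const (c * d) = (Defs.const c * Defs.const d :: 'a cpoly)"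
      by (simp add: const_def mult_single)
  \<comment> \<open>Writing p q - c d as (p - c) q + (q - d) c leaves two multiples of polynomials
    that are zero modulo the ideal.\<close>
  then have "(p * q - Defs.const (c * d)) * q' = (p - Defs.const c) * (q * q') + (q - Defs.const d) *
      (Defs.const c * q')" for q'
    by (simp add: algebra_simps)
  then show ?case using cd assms(2) by (intro exI[of _ "c * d"]) simp
qed

lemma homogeneous_0: "homogeneous 0 p \<Longrightarrow> p = Defs.const (Poly_Mapping.lookup p 0)"
proof (rule poly_mapping_eqI)
  fix t assume hom: "homogeneous 0 p"
  have "t = 0" if "t \<in> Poly_Mapping.keys p"
  proof -
    have "Poly_Mapping.lookup t v = 0" for v
      using hom that unfolding homogeneous_def mdegree_def by (auto simp: in_keys_iff)
    then show ?thesis by (intro poly_mapping_eqI) simp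
  qed
  then show "Poly_Mapping.lookup p t = Poly_Mapping.lookup (Defs.const (Poly_Mapping.lookup p 0)) t"
    unfolding const_def lookup_single by (auto simp: when_def in_keys_iff)
qed

text \<open>If N were below n^2, every generator, and hence \<open>det_poly n\<close>, would be
  constant modulo an ideal in the kernel of \<open>alt_coeff n\<close>. That functional kills
  constants but not the determinant.\<close>

lemma beta_ge:
  assumes n: "n \<ge> 1" and m: "n\<^sup>2 \<le> m"
  shows "beta (R n m) \<ge> enat (n\<^sup>2)"
  unfolding beta_def
proof (rule Inf_greatest, clarify)
  fix N assume gen: "generated_subalgebra {p \<in> R n m. \<exists>d\<le>N. homogeneous d p} = R n m"
  have "n\<^sup>2 \<le> N"
  proof (rule ccontr)
    assume N: "\<not> n\<^sup>2 \<le> N"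
    have gens: "\<exists>c. \<forall>q. alt_coeff n ((p - Defs.const c) * q) = 0"
      if "p \<in> {p \<in> R n m. \<exists>d\<le>N. homogeneous d p}" for p
    proof -
      from that obtain d where d: "p \<in> R n m" "d \<le> N" "homogeneous d p" by blast
      show ?thesis
      proof (cases "d = 0")
        case True
        then have "p - Defs.const (Poly_Mapping.lookup p 0) = 0" using homogeneous_0 d by simp
        then show ?thesis by (metis mult_zero_left alt_coeff_add add_cancel_left_left)
      next
        case False
        have "alt_coeff n ((p - Defs.const 0) * q) = 0" for q
          using alt_coeff_times[OF d(1,3) _ _ m, of q] False d N by (simp add: const_def)
        then show ?thesis by blast
      qed
    qed
    have "det_poly n \<in> generated_subalgebra {p \<in> R n m. \<exists>d\<le>N. homogeneous d p}"
      unfolding gen by (rule det_poly_in_R[OF m])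
    from generated_subalgebra_const_plus[where \<phi> = "alt_coeff n", OF gens alt_coeff_add this]
    obtain c where c: "\<And>q. alt_coeff n ((det_poly n - Defs.const c) * q) = 0" by blast
    \<comment> \<open>Here \<open>n \<ge> 1\<close> enters: the monomials seen by
      \<open>alt_coeff\<close> have degree n^2 > 0, so constants are killed.\<close>
    have "perm_monom n {..<n * n} \<sigma> \<noteq> 0" for \<sigma>
      using n mdegree_multilin_monom[of "{..<n * n}" "\<lambda>s. \<sigma> s div n" "\<lambda>s. \<sigma> s mod n"]
      by (auto simp: mdegree_def)
    then have "alt_coeff n (Defs.const c) = 0"
      unfolding alt_coeff_def const_def lookup_single by (intro sum.neutral) (auto simp: when_def)
    moreover have "alt_coeff n (det_poly n - Defs.const c) + alt_coeff n (Defs.const c) =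
        alt_coeff n (det_poly n)"
      by (simp flip: alt_coeff_add)
    ultimately show False using c[of 1] alt_coeff_det_poly[of n] by simp
  qed
  then show "enat (n\<^sup>2) \<le> enat N" by simp
qed

theorem theorem1p15:
  fixes n :: nat
  assumes "n \<ge> 1"
  shows "(\<forall>m\<ge>n\<^sup>2. beta (R n m) \<ge> enat (n\<^sup>2)) \<and> beta_U n \<ge> enat (n\<^sup>2)"
  using beta_ge[OF assms] by (simp add: beta_U_def)

end
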